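(* Let $N\ge 2$, $s\in(0,1)$, let $\Omega\subset\mathbb{R}^N$ be a bounded $C^2$ domain containing the origin, and let $\mu\in(\mu_0,0)$. Let $Q\in C^\beta_{loc}(\mathbb{R}^N\setminus\{0\})$ for some $\beta\in(0,1)$ be a positive function such that, for some $\theta\in\mathbb{R}$, $$\liminf_{|x|\to0^+}Q(x)|x|^{-\theta}>0\quad\text{and}\quad \limsup_{|x|\to0^+}Q(x)|x|^{-\theta}<+\infty .$$ Set $p^\#_{\mu,\theta}=1+\frac{2s+\theta}{-\tau_+}$. If $\theta\in(\tau_+-2s,-2s)$, then $p^\#_{\mu,\theta}\in(0,1)$, and for $p=p^\#_{\mu,\theta}$ the problem $$\mathcal{L}_\mu^s u\ge Q u^p\ \text{ in }\Omega\setminus\{0\},\qquad u\ge 0\ \text{ in }\mathbb{R}^N\setminus\Omega$$ has infinitely many positive classical solutions.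
   Context: $\mu_0=-2^{2s}\frac{\Gamma^2(\frac{N+2s}{4})}{\Gamma^2(\frac{N-2s}{4})}$. The fractional Laplacian is $(-\Delta)^s u(x)=\lim_{\varepsilon\to0^+}C_{N,s}\int_{\mathbb{R}^N\setminus B_\varepsilon(x)}\frac{u(x)-u(z)}{|x-z|^{N+2s}}dz$, $C_{N,s}=2^{2s}\pi^{-N/2}s\frac{\Gamma(\frac{N+2s}{2})}{\Gamma(1-s)}$, where $B_\varepsilon(x)$ is the ball of radius $\varepsilon$ centred at $x$, and $\mathcal{L}^s_\mu=(-\Delta)^s+\frac{\mu}{|x|^{2s}}$. For $\tau\in(-N,2s)$ let $c_s(\tau)=2^{2s}\frac{\Gamma(\frac{N+\tau}{2})\Gamma(\frac{2s-\tau}{2})}{\Gamma(-\frac{\tau}{2})\Gamma(\frac{N-2s+\tau}{2})}$ (with $1/\Gamma=0$ at poles of $\Gamma$); $c_s$ is strictly concave with maximum $-\mu_0$ attained at $\frac{2s-N}{2}$. For $\mu>\mu_0$, $\tau_-=\tau_-(s,\mu)<\tau_+=\tau_+(s,\mu)$ are the two zeros in $(-N,2s)$ of $c_s(\tau)+\mu$; $\tau_-+\tau_+=2s-N$, and $\tau_+<0$ if $\mu<0$. $L^1_s(\mathbb{R}^N)=\{w\in L^1_{loc}(\mathbb{R}^N):\int_{\mathbb{R}^N}\frac{|w(x)|}{1+|x|^{N+2s}}dx<\infty\}$. A classical solution is a function $u\in L^1_s(\mathbb{R}^N)\cap C(\Omega\setminus\{0\})$ satisfying the inequality pointwise in $\Omega\setminus\{0\}$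 and $u\ge0$ in $\mathbb{R}^N\setminus\Omega$; it is positive if $u>0$ a.e. in $\Omega\setminus\{0\}$. *)

theory Defs
  imports "HOL-Analysis.Analysis"
begin

text \<open>The space \<open>\<real>\<^sup>N\<close> is \<open>real ^ 'n\<close> with \<open>N = CARD('n)\<close>, and integrals are taken with respect
  to \<open>lebesgue\<close>, so that ``measurable'' means Lebesgue measurable.\<close>

subsection \<open>Constants\<close>

definition mu0 :: "nat \<Rightarrow> real \<Rightarrow> real" where
  "mu0 N s = - (2 powr (2 * s) * (Gamma ((real N + 2 * s) / 4))\<^sup>2 / (Gamma ((real N - 2 * s) / 4))\<^sup>2)"

text \<open>The use of \<open>rGamma\<close> implements the convention that \<open>1 / \<Gamma>\<close> vanishes at the poles of \<open>\<Gamma>\<close>.\<close>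

definition c_s :: "nat \<Rightarrow> real \<Rightarrow> real \<Rightarrow> real" where
  "c_s N s \<tau> = 2 powr (2 * s) * Gamma ((real N + \<tau>) / 2) * Gamma ((2 * s - \<tau>) / 2)
                 * rGamma (- \<tau> / 2) * rGamma ((real N - 2 * s + \<tau>) / 2)"

text \<open>For \<open>\<mu> > mu0 N s\<close>, strict concavity of \<open>c_s N s\<close> gives exactly two zeros of
  \<open>c_s N s \<tau> + \<mu>\<close> in \<open>(-N, 2s)\<close>; \<open>tau_plus\<close> is the larger one.\<close>

definition tau_plus :: "nat \<Rightarrow> real \<Rightarrow> real \<Rightarrow> real" where
  "tau_plus N s \<mu> = (GREATEST \<tau>. \<tau> \<in> {- real N <..< 2 * s} \<and> c_s N s \<tau> + \<mu> = 0)"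

definition p_sharp :: "nat \<Rightarrow> real \<Rightarrow> real \<Rightarrow> real \<Rightarrow> real" where
  "p_sharp N s \<mu> \<theta> = 1 + (2 * s + \<theta>) / (- tau_plus N s \<mu>)"

subsection \<open>The operator\<close>

definition C_Ns :: "nat \<Rightarrow> real \<Rightarrow> real" where
  "C_Ns N s = 2 powr (2 * s) * pi powr (- real N / 2) * s
                * Gamma ((real N + 2 * s) / 2) / Gamma (1 - s)"

definition L1s :: "real \<Rightarrow> (real ^ 'n \<Rightarrow> real) set" where
  "L1s s = {w. (\<forall>K. compact K \<longrightarrow> set_integrable lebesgue K w) \<and>
               integrable lebesgue (\<lambda>x. \<bar>w x\<bar> / (1 + norm x powr (real CARD('n) + 2 * s)))}"

text \<open>For \<open>u \<in> L1s s\<close> with \<open>0 < s\<close> the integrand below is integrable over the complement of every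
  ball of radius \<open>\<epsilon> > 0\<close> around \<open>x\<close>, so the integral never takes its default value.\<close>

definition frac_laplacian_trunc :: "real \<Rightarrow> (real ^ 'n \<Rightarrow> real) \<Rightarrow> real ^ 'n \<Rightarrow> real \<Rightarrow> real" where
  "frac_laplacian_trunc s u x \<epsilon> = C_Ns CARD('n) s *
     (LINT z : - ball x \<epsilon> | lebesgue. (u x - u z) / norm (x - z) powr (real CARD('n) + 2 * s))"

definition frac_laplacian_exists :: "real \<Rightarrow> (real ^ 'n \<Rightarrow> real) \<Rightarrow> real ^ 'n \<Rightarrow> bool" where
  "frac_laplacian_exists s u x \<longleftrightarrow> (\<exists>l. (frac_laplacian_trunc s u x \<longlongrightarrow> l) (at_right 0))"

definition frac_laplacian :: "real \<Rightarrow> (real ^ 'n \<Rightarrow> real) \<Rightarrow> real ^ 'n \<Rightarrow> real" where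
  "frac_laplacian s u x = Lim (at_right 0) (frac_laplacian_trunc s u x)"

definition hardy_op :: "real \<Rightarrow> real \<Rightarrow> (real ^ 'n \<Rightarrow> real) \<Rightarrow> real ^ 'n \<Rightarrow> real" where
  "hardy_op s \<mu> u x = frac_laplacian s u x + \<mu> / norm x powr (2 * s) * u x"

subsection \<open>Regularity\<close>

definition C2_fun :: "(real ^ 'n \<Rightarrow> real) \<Rightarrow> bool" where
  "C2_fun f \<longleftrightarrow>
     (\<exists>(f' :: real ^ 'n \<Rightarrow> (real ^ 'n) \<Rightarrow>\<^sub>L real)
       (f'' :: real ^ 'n \<Rightarrow> (real ^ 'n) \<Rightarrow>\<^sub>L ((real ^ 'n) \<Rightarrow>\<^sub>L real)).
        (\<forall>x. (f has_derivative blinfun_apply (f' x)) (at x)) \<and>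
        (\<forall>x. (f' has_derivative blinfun_apply (f'' x)) (at x)) \<and>
        continuous_on UNIV f'')"

text \<open>After a rotation, the set lies locally on one side of the graph of a \<open>C\<^sup>2\<close> function over
  the hyperplane orthogonal to \<open>\<nu>\<close>.  A function on that hyperplane is represented by one on the
  whole space, evaluated at the orthogonal projection \<open>x - (x \<bullet> \<nu>) \<nu>\<close>.\<close>

definition C2_boundary :: "(real ^ 'n) set \<Rightarrow> bool" where
  "C2_boundary \<Omega> \<longleftrightarrow>
     (\<forall>x0 \<in> frontier \<Omega>. \<exists>r > 0. \<exists>\<nu> \<gamma>. norm \<nu> = 1 \<and> C2_fun \<gamma> \<and>
        \<Omega> \<inter> ball x0 r = {x \<in> ball x0 r. x \<bullet> \<nu> > \<gamma> (x - (x \<bullet> \<nu>) *\<^sub>R \<nu>)})"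

definition bounded_C2_domain :: "(real ^ 'n) set \<Rightarrow> bool" where
  "bounded_C2_domain \<Omega> \<longleftrightarrow> open \<Omega> \<and> connected \<Omega> \<and> \<Omega> \<noteq> {} \<and> bounded \<Omega> \<and> C2_boundary \<Omega>"

definition loc_holder_on :: "real \<Rightarrow> (real ^ 'n) set \<Rightarrow> (real ^ 'n \<Rightarrow> real) \<Rightarrow> bool" where
  "loc_holder_on \<beta> U f \<longleftrightarrow>
     (\<forall>K. compact K \<and> K \<subseteq> U \<longrightarrow> (\<exists>C. \<forall>x\<in>K. \<forall>y\<in>K. \<bar>f x - f y\<bar> \<le> C * norm (x - y) powr \<beta>))"

subsection \<open>Solutions\<close>

text \<open>That the inequality holds at \<open>x\<close> includes that the limit defining \<open>(-\<Delta>)\<^sup>s u(x)\<close> exists (as a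
  real number).  The power \<open>u x powr p\<close> has its usual meaning only for \<open>u x \<ge> 0\<close>; for positive
  solutions this holds throughout \<open>\<Omega> - {0}\<close> by continuity.\<close>

definition classical_solution ::
    "real \<Rightarrow> real \<Rightarrow> (real ^ 'n \<Rightarrow> real) \<Rightarrow> real \<Rightarrow> (real ^ 'n) set \<Rightarrow> (real ^ 'n \<Rightarrow> real) \<Rightarrow> bool" where
  "classical_solution s \<mu> Q p \<Omega> u \<longleftrightarrow>
     u \<in> L1s s \<and> continuous_on (\<Omega> - {0}) u \<and>
     (\<forall>x \<in> \<Omega> - {0}. frac_laplacian_exists s u x \<and> hardy_op s \<mu> u x \<ge> Q x * u x powr p) \<and>
     (\<forall>x \<in> - \<Omega>. u x \<ge> 0)"

definition positive_classical_solution ::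
    "real \<Rightarrow> real \<Rightarrow> (real ^ 'n \<Rightarrow> real) \<Rightarrow> real \<Rightarrow> (real ^ 'n) set \<Rightarrow> (real ^ 'n \<Rightarrow> real) \<Rightarrow> bool" where
  "positive_classical_solution s \<mu> Q p \<Omega> u \<longleftrightarrow>
     classical_solution s \<mu> Q p \<Omega> u \<and> (AE x in lebesgue. x \<in> \<Omega> - {0} \<longrightarrow> u x > 0)"

text \<open>Elements of \<open>L\<^sup>1\<close> spaces are identified when they agree almost everywhere.  Counting solutions
  modulo this relation keeps arbitrary changes on null sets (for instance of \<open>u 0\<close>) from
  producing new solutions.\<close>

definition ae_eq_rel :: "((real ^ 'n \<Rightarrow> real) \<times> (real ^ 'n \<Rightarrow> real)) set" where
  "ae_eq_rel = {(u, v). AE x in lebesgue. u x = v x}"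

end

theory Submission
  imports Defs "HOL-Probability.Distributions"
begin

text \<open>Put \<open>u = |x|\<^sup>\<tau>\<close> with \<open>\<tau> = (2 s - N) / 2\<close>, the maximum point of \<open>c_s\<close>.  Then
  \<open>\<L> u = (c_s \<tau> + \<mu>) |x|\<^bsup>\<tau> - 2 s\<^esup>\<close> with a positive constant, while \<open>\<tau> < \<tau>\<^sub>+\<close> and the choice
  of \<open>p\<close> make \<open>Q u\<^sup>p\<close> at most a multiple of \<open>|x|\<^bsup>\<tau> - 2 s\<^esup>\<close> on \<open>\<Omega>\<close>.  As \<open>p < 1\<close>, every
  sufficiently large multiple of \<open>u\<close> is a solution.

  Only the bound \<open>(-\<Delta>)\<^sup>s |x|\<^bsup>-2 a\<^esup> \<ge> c_s (-2 a) |x|\<^bsup>-2 a - 2 s\<^esup>\<close> is needed.  The kernel is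
  regularized to \<open>(\<epsilon> + |x - z|\<^sup>2)\<^bsup>-N/2 - s\<^esup>\<close>; writing this kernel and \<open>|z|\<^bsup>-2 a\<^esup>\<close> as mixtures of
  Gaussians turns the regularized operator into a one-dimensional integral with nonnegative
  integrand, and Fatou's lemma bounds its limit for \<open>\<epsilon> \<rightarrow> 0\<close> from below by a Beta integral.\<close>

subsection \<open>Gamma, Beta and Gaussian integrals\<close>

text \<open>The singular kernel is not integrable near \<open>x\<close>, so the two halves of
  \<open>u x - u z\<close> cannot be integrated separately. With the regularized kernel both halves
  are finite, though each diverges as \<epsilon> tends to 0; they become integrals over one common
  variable \<open>v\<close> and are subtracted there, under the integral sign, before the limit. The
  operator itself is defined by truncation, not by regularization. The two limits agree because
  symmetrizing \<open>z = x + y\<close> with \<open>z = x - y\<close> turns either integral into one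
  of a second difference, which is absolutely integrable against the singular kernel. The midpoint
  exponent is chosen because \<open>c_s\<close> has the explicit value \<open>- mu0 N s\<close>
  there, so that positivity of the constant is the hypothesis on \<mu> itself. The relation
  \<open>(1 - p) * tau_plus = 2 * s + \<theta>\<close> makes the exponent of the source exceed
  \<tau> - 2s by (1 - p) times the gap between \<open>tau_plus\<close> and \<tau>; on a bounded
  domain this surplus is absorbed into a constant.\<close>

definition pos_lborel :: "real measure" where
  "pos_lborel = density lborel (indicator {0<..})"

lemma sets_pos_lborel [measurable_cong, simp]: "sets pos_lborel = sets borel"
  by (simp add: pos_lborel_def)

lemma AE_pos_lborel: "AE x in pos_lborel. 0 < x"
  unfolding pos_lborel_def by (subst AE_density) (auto simp: indicator_def)

lemma nn_integral_pos_lborel: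
  "f \<in> borel_measurable borel \<Longrightarrow>
     (\<integral>\<^sup>+x. f x \<partial>pos_lborel) = (\<integral>\<^sup>+x. indicator {0<..} x * f x \<partial>lborel)"
  unfolding pos_lborel_def by (subst nn_integral_density) auto

lemma nn_integral_pos_cong:
  "(\<And>x. 0 < x \<Longrightarrow> f x = g x) \<Longrightarrow> (\<integral>\<^sup>+x. f x \<partial>pos_lborel) = (\<integral>\<^sup>+x. g x \<partial>pos_lborel)"
  by (rule nn_integral_cong_AE) (use AE_pos_lborel in auto)

lemma nn_integral_pos_mono:
  "(\<And>x. 0 < x \<Longrightarrow> f x \<le> g x) \<Longrightarrow> (\<integral>\<^sup>+x. f x \<partial>pos_lborel) \<le> (\<integral>\<^sup>+x. g x \<partial>pos_lborel)"
  by (rule nn_integral_mono_AE) (use AE_pos_lborel in auto)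

lemma sigma_finite_pos_lborel: "sigma_finite_measure pos_lborel"
  unfolding pos_lborel_def
  by (subst sigma_finite_measure.sigma_finite_iff_density_finite[OF sigma_finite_lborel]) (auto simp: indicator_def)

interpretation pos_lborel: sigma_finite_measure pos_lborel
  by (rule sigma_finite_pos_lborel)

lemma nn_integral_pos_swap:
  assumes "case_prod f \<in> borel_measurable (M \<Otimes>\<^sub>M pos_lborel)" "sigma_finite_measure M"
  shows "(\<integral>\<^sup>+y. \<integral>\<^sup>+x. f x y \<partial>M \<partial>pos_lborel) = (\<integral>\<^sup>+x. \<integral>\<^sup>+y. f x y \<partial>pos_lborel \<partial>M)"
proof -
  interpret pair_sigma_finite M pos_lborel
    by (simp add: pair_sigma_finite_def sigma_finite_pos_lborel assms)
  show ?thesis by (rule Fubini') (use assms in auto)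
qed

lemma nn_integral_pos_scale:
  assumes [measurable]: "f \<in> borel_measurable borel" and c: "0 < c"
  shows "(\<integral>\<^sup>+x. f x \<partial>pos_lborel) = ennreal c * (\<integral>\<^sup>+x. f (c * x) \<partial>pos_lborel)"
proof -
  have "(\<integral>\<^sup>+x. f x \<partial>pos_lborel) = ennreal \<bar>c\<bar> * (\<integral>\<^sup>+x. indicator {0<..} (0 + c * x) * f (0 + c * x) \<partial>lborel)"
    unfolding nn_integral_pos_lborel[OF assms(1)]
    using c by (intro nn_integral_real_affine) auto
  then show ?thesis
    using c by (simp add: nn_integral_pos_lborel indicator_def zero_less_mult_iff)
qed

lemma nn_integral_ennreal_cmult:
  assumes "0 \<le> c" "f \<in> borel_measurable M"
  shows "(\<integral>\<^sup>+x. ennreal (c * f x) \<partial>M) = ennreal c * (\<integral>\<^sup>+x. ennreal (f x) \<partial>M)"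
  using assms by (simp add: ennreal_mult' nn_integral_cmult)

text \<open>Rescaling \<open>r\<close> by \<open>1 / c\<close> reduces this to Euler's integral.
  Read from right to left it writes the negative power \<open>c powr (- q)\<close> as a mixture of
  exponentials, which is how Gaussians enter below.\<close>

lemma nn_integral_gamma:
  assumes "0 < q" "0 < c"
  shows "(\<integral>\<^sup>+r. ennreal (r powr (q - 1) * exp (- (r * c))) \<partial>pos_lborel)
           = ennreal (Gamma q * c powr (- q))"
proof -
  have G: "(\<integral>\<^sup>+r. ennreal (r powr (q - 1) * exp (- r)) \<partial>pos_lborel) = ennreal (Gamma q)"
    unfolding Gamma_conv_nn_integral_real[OF assms(1)]
    by (subst nn_integral_pos_lborel)
       (auto intro!: nn_integral_cong split: split_indicator simp: exp_minus field_simps)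
  have "(\<integral>\<^sup>+r. ennreal (r powr (q - 1) * exp (- (r * c))) \<partial>pos_lborel)
      = ennreal (1/c) * (\<integral>\<^sup>+r. ennreal ((1/c * r) powr (q - 1) * exp (- (1/c * r * c))) \<partial>pos_lborel)"
    using assms by (intro nn_integral_pos_scale) auto
  also have "(\<integral>\<^sup>+r. ennreal ((1/c * r) powr (q - 1) * exp (- (1/c * r * c))) \<partial>pos_lborel)
      = (\<integral>\<^sup>+r. ennreal ((1/c) powr (q - 1)) * ennreal (r powr (q - 1) * exp (- r)) \<partial>pos_lborel)"
  proof (rule nn_integral_pos_cong)
    fix r :: real assume "0 < r"
    then have "(1/c * r) powr (q - 1) = (1/c) powr (q - 1) * r powr (q - 1)"
      using assms by (simp add: powr_mult powr_divide)
    moreover have "1/c * r * c = r" using assms by simp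
    ultimately show "ennreal ((1/c * r) powr (q - 1) * exp (- (1/c * r * c)))
        = ennreal ((1/c) powr (q - 1)) * ennreal (r powr (q - 1) * exp (- r))"
      by (simp only: ennreal_mult[symmetric] powr_ge_zero exp_ge_zero mult_nonneg_nonneg mult.assoc)
  qed
  also have "\<dots> = ennreal ((1/c) powr (q - 1)) * ennreal (Gamma q)"
    by (subst nn_integral_cmult) (auto simp: G)
  also have "ennreal (1/c) * \<dots> = ennreal (1/c * ((1/c) powr (q - 1) * Gamma q))"
    using assms by (simp add: less_imp_le[OF Gamma_real_pos] flip: ennreal_mult)
  also have "1/c * ((1/c) powr (q - 1) * Gamma q) = Gamma q * c powr (- q)"
    using assms by (simp add: powr_diff powr_minus_divide powr_divide)
  finally show ?thesis .
qed

text \<open>A Beta integral on the half-line, with scales \<open>e\<close> and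
  \<open>\<rho>\<close>. The power of \<open>e + \<rho> * v\<close> is replaced by its exponential
  mixture; after exchanging the integrals, both the \<open>v\<close>- and the
  \<open>r\<close>-integral are Gamma integrals.\<close>

lemma nn_integral_beta:
  assumes a: "0 < a" and s: "0 < s" and e: "0 < e" and \<rho>: "0 < \<rho>"
  shows "(\<integral>\<^sup>+v. ennreal (v powr (a - 1) * (e + \<rho> * v) powr (- a - s)) \<partial>pos_lborel)
           = ennreal (Gamma a * Gamma s / Gamma (a + s) * \<rho> powr (- a) * e powr (- s))"
proof -
  have G: "0 < Gamma a" "0 < Gamma s" "0 < Gamma (a + s)" using a s by (auto intro!: Gamma_real_pos)
  have "ennreal (Gamma (a + s)) * (\<integral>\<^sup>+v. ennreal (v powr (a - 1) * (e + \<rho> * v) powr (- a - s)) \<partial>pos_lborel)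
     = (\<integral>\<^sup>+v. ennreal (Gamma (a + s)) * ennreal (v powr (a - 1) * (e + \<rho> * v) powr (- a - s)) \<partial>pos_lborel)"
    by (subst nn_integral_cmult) auto
  also have "\<dots> = (\<integral>\<^sup>+v. (\<integral>\<^sup>+r. ennreal (v powr (a - 1) * (r powr (a + s - 1) * exp (- (r * (e + \<rho> * v))))) \<partial>pos_lborel) \<partial>pos_lborel)"
  proof (rule nn_integral_pos_cong)
    fix v :: real assume "0 < v"
    then have p: "0 < e + \<rho> * v" using e \<rho> by (simp add: add_pos_pos)
    have "(\<integral>\<^sup>+r. ennreal (v powr (a - 1) * (r powr (a + s - 1) * exp (- (r * (e + \<rho> * v))))) \<partial>pos_lborel)
        = ennreal (v powr (a - 1)) * ennreal (Gamma (a + s) * (e + \<rho> * v) powr - (a + s))"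
      using p a s by (subst nn_integral_ennreal_cmult) (auto simp: nn_integral_gamma)
    then show "ennreal (Gamma (a + s)) * ennreal (v powr (a - 1) * (e + \<rho> * v) powr (- a - s))
        = (\<integral>\<^sup>+r. ennreal (v powr (a - 1) * (r powr (a + s - 1) * exp (- (r * (e + \<rho> * v))))) \<partial>pos_lborel)"
      using G by (simp add: mult_ac flip: ennreal_mult)
  qed
  also have "\<dots> = (\<integral>\<^sup>+r. (\<integral>\<^sup>+v. ennreal (v powr (a - 1) * (r powr (a + s - 1) * exp (- (r * (e + \<rho> * v))))) \<partial>pos_lborel) \<partial>pos_lborel)"
    by (rule nn_integral_pos_swap) (auto simp: sigma_finite_pos_lborel)
  also have "\<dots> = (\<integral>\<^sup>+r. ennreal (Gamma a * \<rho> powr (- a)) * ennreal (r powr (s - 1) * exp (- (r * e))) \<partial>pos_lborel)"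
  proof (rule nn_integral_pos_cong)
    fix r :: real assume r: "0 < r"
    have "exp (- (r * (e + \<rho> * v))) = exp (- (r * e)) * exp (- (v * (r * \<rho>)))" for v
      by (simp add: exp_add[symmetric] algebra_simps)
    then have "(\<integral>\<^sup>+v. ennreal (v powr (a - 1) * (r powr (a + s - 1) * exp (- (r * (e + \<rho> * v))))) \<partial>pos_lborel)
        = (\<integral>\<^sup>+v. ennreal (r powr (a + s - 1) * exp (- (r * e))) * ennreal (v powr (a - 1) * exp (- (v * (r * \<rho>)))) \<partial>pos_lborel)"
      by (simp add: mult_ac flip: ennreal_mult)
    also have "\<dots> = ennreal (r powr (a + s - 1) * exp (- (r * e))) * ennreal (Gamma a * (r * \<rho>) powr (- a))"
      using r a \<rho> by (subst nn_integral_cmult) (auto simp: nn_integral_gamma)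
    also have "\<dots> = ennreal ((r powr (a + s - 1) * exp (- (r * e))) * (Gamma a * (r * \<rho>) powr (- a)))"
      using G by (simp flip: ennreal_mult)
    also have "(r powr (a + s - 1) * exp (- (r * e))) * (Gamma a * (r * \<rho>) powr (- a))
       = (Gamma a * \<rho> powr (- a)) * ((r powr (a + s - 1) * r powr (- a)) * exp (- (r * e)))"
      using r \<rho> by (simp add: powr_mult)
    also have "r powr (a + s - 1) * r powr (- a) = r powr (s - 1)"
      by (simp flip: powr_add)
    finally show "(\<integral>\<^sup>+v. ennreal (v powr (a - 1) * (r powr (a + s - 1) * exp (- (r * (e + \<rho> * v))))) \<partial>pos_lborel)
       = ennreal (Gamma a * \<rho> powr (- a)) * ennreal (r powr (s - 1) * exp (- (r * e)))"
      using G by (simp flip: ennreal_mult)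
  qed
  also have "\<dots> = ennreal (Gamma a * \<rho> powr (- a) * (Gamma s * e powr (- s)))"
    using G s e by (subst nn_integral_cmult) (auto simp: nn_integral_gamma simp flip: ennreal_mult)
  also have "\<dots> = ennreal (Gamma (a + s) * (Gamma a * Gamma s / Gamma (a + s) * \<rho> powr (- a) * e powr (- s)))"
    using G by simp
  also have "\<dots> = ennreal (Gamma (a + s)) * ennreal (Gamma a * Gamma s / Gamma (a + s) * \<rho> powr (- a) * e powr (- s))"
    using G by (intro ennreal_mult) auto
  finally show ?thesis
    using G by (subst (asm) ennreal_mult_cancel_left) auto
qed

text \<open>The integrand is \<open>sqrt (pi / c)\<close> times a normal density with variance
  \<open>1 / (2 * c)\<close>, whose total mass is 1.\<close>

lemma nn_integral_gaussian_1:
  assumes c: "0 < c"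
  shows "(\<integral>\<^sup>+z. ennreal (exp (- (c * (z - m)\<^sup>2))) \<partial>lborel) = ennreal (sqrt (pi / c))"
proof -
  define \<sigma> where "\<sigma> = 1 / sqrt (2 * c)"
  have \<sigma>: "\<sigma> > 0" "2 * \<sigma>\<^sup>2 = 1 / c" using c by (auto simp: \<sigma>_def power_divide)
  have "exp (- (c * (z - m)\<^sup>2)) = sqrt (pi / c) * normal_density m \<sigma> z" for z
  proof -
    have "2 * pi * \<sigma>\<^sup>2 = pi / c" using \<sigma> by (metis mult.assoc mult.commute times_divide_eq_right mult_1_right)
    moreover have "(z - m)\<^sup>2 / (2 * \<sigma>\<^sup>2) = c * (z - m)\<^sup>2" using \<sigma> by simp
    ultimately show ?thesis using c by (simp add: normal_density_def)
  qed
  then have "(\<integral>\<^sup>+z. ennreal (exp (- (c * (z - m)\<^sup>2))) \<partial>lborel)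
      = (\<integral>\<^sup>+z. ennreal (sqrt (pi / c)) * ennreal (normal_density m \<sigma> z) \<partial>lborel)"
    using c by (simp flip: ennreal_mult)
  also have "\<dots> = ennreal (sqrt (pi / c)) * 1"
    using \<sigma> by (subst nn_integral_cmult)
      (auto simp: nn_integral_eq_integral normal_density_nonneg)
  finally show ?thesis by simp
qed

lemma nn_integral_gaussian:
  fixes m :: "'a::euclidean_space"
  assumes c: "0 < c"
  shows "(\<integral>\<^sup>+z. ennreal (exp (- (c * (norm (z - m))\<^sup>2))) \<partial>lborel)
           = ennreal ((pi / c) powr (DIM('a) / 2))"
proof -
  have "exp (- (c * (norm (z - m))\<^sup>2)) = (\<Prod>b\<in>Basis. exp (- (c * (z \<bullet> b - m \<bullet> b)\<^sup>2)))" for z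
    unfolding power2_norm_eq_inner euclidean_inner[of "z - m" "z - m"]
    by (simp add: exp_sum[symmetric] sum_negf sum_distrib_left[symmetric] inner_diff_left power2_eq_square)
  then have "(\<integral>\<^sup>+z. ennreal (exp (- (c * (norm (z - m))\<^sup>2))) \<partial>lborel)
     = (\<integral>\<^sup>+z. (\<Prod>b\<in>Basis. ennreal (exp (- (c * (z \<bullet> b - m \<bullet> b)\<^sup>2)))) \<partial>lborel)"
    by (simp add: prod_ennreal)
  also have "\<dots> = (\<Prod>b\<in>(Basis::'a set). ennreal (sqrt (pi / c)))"
    by (subst nn_integral_lborel_prod) (auto simp: nn_integral_gaussian_1 c)
  also have "\<dots> = ennreal ((pi / c) powr (DIM('a) / 2))"
    using c by (simp add: ennreal_power powr_half_sqrt[symmetric] powr_realpow[symmetric] powr_powr)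
  finally show ?thesis .
qed

text \<open>Completing the square: two Gaussians centred at 0 and \<open>x\<close> multiply to one
  centred at \<open>k *\<^sub>R x\<close> with \<open>k = r / (t + r)\<close>, times a factor that
  does not involve \<open>z\<close>.\<close>

lemma nn_integral_gaussian_mult:
  fixes x :: "'a::euclidean_space"
  assumes "0 < t" "0 < r"
  shows "(\<integral>\<^sup>+z. ennreal (exp (- (t * (norm z)\<^sup>2)) * exp (- (r * (norm (x - z))\<^sup>2))) \<partial>lborel)
           = ennreal ((pi / (t + r)) powr (DIM('a) / 2) * exp (- (t * r / (t + r) * (norm x)\<^sup>2)))"
proof -
  define k where "k = r / (t + r)"
  have k: "t * r / (t + r) = k * t" "r = k * (t + r)" using assms by (auto simp: k_def)
  have "t * (norm z)\<^sup>2 + r * (norm (x - z))\<^sup>2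
      = (t + r) * (norm (z - k *\<^sub>R x))\<^sup>2 + k * t * (norm x)\<^sup>2" for z
  proof -
    have "(t + r) * (norm (z - k *\<^sub>R x))\<^sup>2 + k * t * (norm x)\<^sup>2
        = (t + r) * (z \<bullet> z) - 2 * (k * (t + r)) * (z \<bullet> x) + k * (k * (t + r)) * (x \<bullet> x) + k * t * (x \<bullet> x)"
      unfolding power2_norm_eq_inner
      by (simp add: inner_diff_left inner_diff_right inner_commute algebra_simps)
    also have "\<dots> = (t + r) * (z \<bullet> z) - 2 * r * (z \<bullet> x) + k * (t + r) * (x \<bullet> x)"
    proof -
      have "k * (k * (t + r)) + k * t = k * (t + r)"
        using k(2) by (metis add.commute distrib_left)
      then have "k * (k * (t + r)) * (x \<bullet> x) + k * t * (x \<bullet> x) = k * (t + r) * (x \<bullet> x)"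
        by (metis distrib_right)
      then show ?thesis by (simp only: k(2)[symmetric])
    qed
    also have "\<dots> = (t + r) * (z \<bullet> z) - 2 * r * (z \<bullet> x) + r * (x \<bullet> x)"
      by (simp only: k(2)[symmetric])
    also have "\<dots> = t * (norm z)\<^sup>2 + r * (norm (x - z))\<^sup>2"
      unfolding power2_norm_eq_inner
      by (simp add: inner_diff_left inner_diff_right inner_commute algebra_simps)
    finally show ?thesis by simp
  qed
  then have eq: "exp (- (t * (norm z)\<^sup>2)) * exp (- (r * (norm (x - z))\<^sup>2))
     = exp (- (k * t * (norm x)\<^sup>2)) * exp (- ((t + r) * (norm (z - k *\<^sub>R x))\<^sup>2))" for z
    by (simp flip: exp_add) (metis add.commute minus_add_distrib diff_conv_add_uminus)
  show ?thesis unfolding eq k(1)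
    using assms by (simp add: ennreal_mult nn_integral_cmult nn_integral_gaussian mult.commute)
qed

subsection \<open>Regularized Riesz kernels\<close>

text \<open>The parameter \<open>t\<close> resolves the power of \<open>norm z\<close> and
  \<open>r\<close> the kernel; the \<open>z\<close>-integral is then Gaussian and explicit. The
  identity lives in the extended nonnegative reals, so it also covers exponents \<open>a\<close> for
  which both sides are infinite.\<close>

lemma nn_integral_riesz:
  fixes x :: "'a::euclidean_space"
  assumes a: "0 < a" and s: "0 < s" and e: "0 < e"
  defines "h \<equiv> real DIM('a) / 2"
  shows "(\<integral>\<^sup>+z. ennreal (norm z powr (- 2 * a) * (e + (norm (x - z))\<^sup>2) powr (- (h + s))) \<partial>lborel)
    = ennreal (pi powr h * Gamma (a + s) / (Gamma a * Gamma (h + s))) *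
      (\<integral>\<^sup>+v. ennreal (v powr (a - 1) * ((1 + v) powr (- h) *
              (e + (norm x)\<^sup>2 * (v / (1 + v))) powr (- (a + s)))) \<partial>pos_lborel)"
    (is "?L = ennreal ?K * ?R")
proof -
  have h: "0 < h" by (simp add: h_def)
  have G: "0 < Gamma a" "0 < Gamma (a + s)" "0 < Gamma (h + s)"
    using a s h by (auto intro!: Gamma_real_pos add_pos_pos)
  define w where "w r t = r powr (h + s - 1) * exp (- (r * e)) * t powr (a - 1)" for r t
  define g where "g z r t = exp (- (t * (norm z)\<^sup>2)) * exp (- (r * (norm (x - z))\<^sup>2))" for z r t
  have [measurable]: "(\<lambda>(r, t). w r t) \<in> borel_measurable (borel \<Otimes>\<^sub>M borel)"
    unfolding w_def by measurable
  have [measurable]: "(\<lambda>(z, r, t). g z r t) \<in> borel_measurable (borel \<Otimes>\<^sub>M borel \<Otimes>\<^sub>M borel)"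
    unfolding g_def by measurable
  have w0: "0 \<le> w r t" for r t by (simp add: w_def)
  have g0: "0 \<le> g z r t" for z r t by (simp add: g_def)
  have "ennreal (Gamma a * Gamma (h + s)) * ?L
      = (\<integral>\<^sup>+z. ennreal (Gamma a * Gamma (h + s) * (norm z powr (- 2 * a) * (e + (norm (x - z))\<^sup>2) powr (- (h + s)))) \<partial>lborel)"
    using G by (subst nn_integral_ennreal_cmult) auto
  also have "\<dots> = (\<integral>\<^sup>+z. \<integral>\<^sup>+r. \<integral>\<^sup>+t. ennreal (w r t * g z r t) \<partial>pos_lborel \<partial>pos_lborel \<partial>lborel)"
  proof (rule nn_integral_cong_AE)
    \<comment> \<open>At \<open>z = 0\<close> the term \<open>norm z powr (- 2 * a)\<close> is 0 by
      convention while the mixture over \<open>t\<close> diverges, so the origin is discarded as a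
      null set.\<close>
    have K: "(\<integral>\<^sup>+r. \<integral>\<^sup>+t. ennreal (w r t * g z r t) \<partial>pos_lborel \<partial>pos_lborel)
        = ennreal (Gamma a * Gamma (h + s) * (norm z powr (- 2 * a) * (e + (norm (x - z))\<^sup>2) powr (- (h + s))))"
      if z: "z \<noteq> 0" for z
    proof -
      have p: "0 < e + (norm (x - z))\<^sup>2" using e by (simp add: add_pos_nonneg)
      have "w r t * g z r t = (r powr (h + s - 1) * exp (- (r * (e + (norm (x - z))\<^sup>2))))
          * (t powr (a - 1) * exp (- (t * (norm z)\<^sup>2)))" for r t
        by (simp add: w_def g_def exp_add[symmetric] algebra_simps)
      then have "(\<integral>\<^sup>+r. \<integral>\<^sup>+t. ennreal (w r t * g z r t) \<partial>pos_lborel \<partial>pos_lborel)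
        = (\<integral>\<^sup>+r. ennreal ((Gamma a * (norm z)\<^sup>2 powr (- a)) * (r powr (h + s - 1) * exp (- (r * (e + (norm (x - z))\<^sup>2))))) \<partial>pos_lborel)"
        using a z G
        by (simp only:) (subst nn_integral_ennreal_cmult, auto simp: nn_integral_gamma mult_ac simp flip: ennreal_mult)
      also have "\<dots> = ennreal ((Gamma a * (norm z)\<^sup>2 powr (- a)) * (Gamma (h + s) * (e + (norm (x - z))\<^sup>2) powr (- (h + s))))"
        using G h s p by (subst nn_integral_ennreal_cmult) (auto simp: nn_integral_gamma simp flip: ennreal_mult)
      also have "(norm z)\<^sup>2 powr (- a) = norm z powr (- 2 * a)"
        using z by (simp add: powr_powr flip: powr_numeral)
      finally show ?thesis by (simp add: mult_ac)
    qed
    show "AE z in lborel. ennreal (Gamma a * Gamma (h + s) * (norm z powr (- 2 * a) * (e + (norm (x - z))\<^sup>2) powr (- (h + s))))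
       = (\<integral>\<^sup>+r. \<integral>\<^sup>+t. ennreal (w r t * g z r t) \<partial>pos_lborel \<partial>pos_lborel)"
      by (rule AE_mp[OF AE_lborel_singleton[of "0::'a"]], rule AE_I2) (intro impI K[symmetric])
  qed
  also have "\<dots> = (\<integral>\<^sup>+r. \<integral>\<^sup>+z. \<integral>\<^sup>+t. ennreal (w r t * g z r t) \<partial>pos_lborel \<partial>lborel \<partial>pos_lborel)"
    by (rule nn_integral_pos_swap[symmetric]) (auto simp: sigma_finite_lborel w_def g_def)
  also have "\<dots> = (\<integral>\<^sup>+r. \<integral>\<^sup>+t. \<integral>\<^sup>+z. ennreal (w r t * g z r t) \<partial>lborel \<partial>pos_lborel \<partial>pos_lborel)"
    by (intro nn_integral_cong nn_integral_pos_swap[symmetric]) (auto simp: sigma_finite_lborel w_def g_def)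
  also have "\<dots> = (\<integral>\<^sup>+r. \<integral>\<^sup>+v. ennreal (pi powr h * (v powr (a - 1) * (1 + v) powr (- h)) *
        (r powr (a + s - 1) * exp (- (r * (e + (norm x)\<^sup>2 * (v / (1 + v))))))) \<partial>pos_lborel \<partial>pos_lborel)"
  proof (rule nn_integral_pos_cong)
    fix r :: real assume r: "0 < r"
    let ?f = "\<lambda>t. ennreal (w r t * ((pi / (t + r)) powr h * exp (- (t * r / (t + r) * (norm x)\<^sup>2))))"
    have "(\<integral>\<^sup>+t. \<integral>\<^sup>+z. ennreal (w r t * g z r t) \<partial>lborel \<partial>pos_lborel) = (\<integral>\<^sup>+t. ?f t \<partial>pos_lborel)"
    proof (rule nn_integral_pos_cong)
      fix t :: real assume "0 < t"
      then show "(\<integral>\<^sup>+z. ennreal (w r t * g z r t) \<partial>lborel) = ?f t"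
        using r w0[of r t] unfolding g_def h_def
        by (subst nn_integral_ennreal_cmult) (auto simp: nn_integral_gaussian_mult simp flip: ennreal_mult)
    qed
    text \<open>Scaling \<open>t = r v\<close> makes the exponent linear in \<open>r\<close>, so that \<open>r\<close> can be integrated out.\<close>
    also have "\<dots> = ennreal r * (\<integral>\<^sup>+v. ?f (r * v) \<partial>pos_lborel)"
      using r by (intro nn_integral_pos_scale) auto
    also have "\<dots> = (\<integral>\<^sup>+v. ennreal (r * (w r (r * v) * ((pi / (r * v + r)) powr h * exp (- (r * v * r / (r * v + r) * (norm x)\<^sup>2))))) \<partial>pos_lborel)"
      using r by (subst nn_integral_ennreal_cmult) auto
    also have "\<dots> = (\<integral>\<^sup>+v. ennreal (pi powr h * (v powr (a - 1) * (1 + v) powr (- h)) *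
        (r powr (a + s - 1) * exp (- (r * (e + (norm x)\<^sup>2 * (v / (1 + v))))))) \<partial>pos_lborel)"
    proof (intro nn_integral_pos_cong arg_cong[where f = ennreal])
      fix v :: real assume v: "0 < v"
      have eq: "r * v + r = r * (1 + v)" by (simp add: algebra_simps)
      have 1: "(pi / (r * v + r)) powr h = pi powr h * r powr (- h) * (1 + v) powr (- h)"
        unfolding eq using r v by (simp add: powr_divide powr_mult powr_minus divide_simps)
      have 2: "r * v * r / (r * v + r) = r * (v / (1 + v))"
        unfolding eq using r v by simp
      have 3: "exp (- (r * e)) * exp (- (r * (v / (1 + v)) * (norm x)\<^sup>2)) = exp (- (r * (e + (norm x)\<^sup>2 * (v / (1 + v)))))"
        by (simp add: exp_add[symmetric] algebra_simps)
      \<comment> \<open>The leading \<open>r\<close> is the Jacobian of the scaling. The exponent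
        \<open>h\<close> cancels, which leaves a Gamma integral of order
        \<open>a + s\<close>.\<close>
      have 4: "r * r powr (h + s - 1) * r powr (a - 1) * r powr (- h) = r powr (a + s - 1)"
      proof -
        have "r * r powr (h + s - 1) * r powr (a - 1) * r powr (- h)
           = r powr 1 * r powr (h + s - 1) * r powr (a - 1) * r powr (- h)" using r by simp
        also have "\<dots> = r powr (a + s - 1)" unfolding powr_add[symmetric] by (simp add: algebra_simps)
        finally show ?thesis .
      qed
      have 5: "(r * v) powr (a - 1) = r powr (a - 1) * v powr (a - 1)" using r v by (simp add: powr_mult)
      show "r * (w r (r * v) * ((pi / (r * v + r)) powr h * exp (- (r * v * r / (r * v + r) * (norm x)\<^sup>2))))
        = pi powr h * (v powr (a - 1) * (1 + v) powr (- h)) * (r powr (a + s - 1) * exp (- (r * (e + (norm x)\<^sup>2 * (v / (1 + v))))))"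
        unfolding 1 2 3[symmetric] 4[symmetric] w_def 5 by (simp only: mult_ac)
    qed
    finally show "(\<integral>\<^sup>+t. \<integral>\<^sup>+z. ennreal (w r t * g z r t) \<partial>lborel \<partial>pos_lborel) = \<dots>" .
  qed
  also have "\<dots> = (\<integral>\<^sup>+v. \<integral>\<^sup>+r. ennreal (pi powr h * (v powr (a - 1) * (1 + v) powr (- h)) *
        (r powr (a + s - 1) * exp (- (r * (e + (norm x)\<^sup>2 * (v / (1 + v))))))) \<partial>pos_lborel \<partial>pos_lborel)"
    by (rule nn_integral_pos_swap) (auto simp: sigma_finite_pos_lborel)
  also have "\<dots> = (\<integral>\<^sup>+v. ennreal ((pi powr h * Gamma (a + s)) * (v powr (a - 1) * ((1 + v) powr (- h) *
              (e + (norm x)\<^sup>2 * (v / (1 + v))) powr (- (a + s))))) \<partial>pos_lborel)"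
  proof (rule nn_integral_pos_cong)
    fix v :: real assume "0 < v"
    then have p: "0 < e + (norm x)\<^sup>2 * (v / (1 + v))" using e by (intro add_pos_nonneg) auto
    show "(\<integral>\<^sup>+r. ennreal (pi powr h * (v powr (a - 1) * (1 + v) powr (- h)) *
        (r powr (a + s - 1) * exp (- (r * (e + (norm x)\<^sup>2 * (v / (1 + v))))))) \<partial>pos_lborel)
      = ennreal ((pi powr h * Gamma (a + s)) * (v powr (a - 1) * ((1 + v) powr (- h) *
              (e + (norm x)\<^sup>2 * (v / (1 + v))) powr (- (a + s)))))"
      using a s G nn_integral_gamma[OF _ p, of "a + s"]
      by (subst nn_integral_ennreal_cmult) (auto simp: mult_ac simp flip: ennreal_mult)
  qed
  also have "\<dots> = ennreal (pi powr h * Gamma (a + s)) * ?R"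
    using G by (subst nn_integral_ennreal_cmult) auto
  also have "\<dots> = ennreal (Gamma a * Gamma (h + s)) * (ennreal ?K * ?R)"
    using G by (simp flip: ennreal_mult mult.assoc)
  finally show ?thesis
    using G by (subst (asm) ennreal_mult_cancel_left) auto
qed

text \<open>Total mass of the regularized kernel, by the same exponential mixture. The factor
  \<open>e powr (- s)\<close> blows up as \<open>e\<close> tends to 0: the limit can only be taken
  after this term has been combined with the Riesz integral.\<close>

lemma nn_integral_kernel:
  fixes x :: "'a::euclidean_space"
  assumes s: "0 < s" and e: "0 < e"
  defines "h \<equiv> real DIM('a) / 2"
  shows "(\<integral>\<^sup>+z. ennreal ((e + (norm (z - x))\<^sup>2) powr (- (h + s))) \<partial>lborel)
    = ennreal (pi powr h * Gamma s / Gamma (h + s) * e powr (- s))"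
    (is "?L = _")
proof -
  have h: "0 < h" by (simp add: h_def)
  have G: "0 < Gamma s" "0 < Gamma (h + s)"
    using s h by (auto intro!: Gamma_real_pos add_pos_pos)
  have "ennreal (Gamma (h + s)) * ?L
     = (\<integral>\<^sup>+z. ennreal (Gamma (h + s) * (e + (norm (z - x))\<^sup>2) powr (- (h + s))) \<partial>lborel)"
    using G by (subst nn_integral_ennreal_cmult) auto
  also have "\<dots> = (\<integral>\<^sup>+z. \<integral>\<^sup>+r. ennreal (r powr (h + s - 1) * exp (- (r * (e + (norm (z - x))\<^sup>2)))) \<partial>pos_lborel \<partial>lborel)"
    using e h s by (simp add: nn_integral_gamma add_pos_nonneg)
  also have "\<dots> = (\<integral>\<^sup>+r. \<integral>\<^sup>+z. ennreal (r powr (h + s - 1) * exp (- (r * (e + (norm (z - x))\<^sup>2)))) \<partial>lborel \<partial>pos_lborel)"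
    by (rule nn_integral_pos_swap[symmetric]) (auto simp: sigma_finite_lborel)
  also have "\<dots> = (\<integral>\<^sup>+r. ennreal (pi powr h * (r powr (s - 1) * exp (- (r * e)))) \<partial>pos_lborel)"
  proof (rule nn_integral_pos_cong)
    fix r :: real assume r: "0 < r"
    have "r powr (h + s - 1) * exp (- (r * (e + (norm (z - x))\<^sup>2)))
       = (r powr (h + s - 1) * exp (- (r * e))) * exp (- (r * (norm (z - x))\<^sup>2))" for z
      by (simp add: exp_add[symmetric] algebra_simps)
    then have "(\<integral>\<^sup>+z. ennreal (r powr (h + s - 1) * exp (- (r * (e + (norm (z - x))\<^sup>2)))) \<partial>lborel)
       = ennreal ((r powr (h + s - 1) * exp (- (r * e))) * (pi / r) powr h)"
      using r by (simp only:) (subst nn_integral_ennreal_cmult, auto simp: nn_integral_gaussian h_def simp flip: ennreal_mult)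
    also have "(r powr (h + s - 1) * exp (- (r * e))) * (pi / r) powr h
       = pi powr h * ((r powr (h + s - 1) * r powr (- h)) * exp (- (r * e)))"
      using r by (simp add: powr_divide powr_minus divide_simps)
    also have "r powr (h + s - 1) * r powr (- h) = r powr (s - 1)"
      by (simp flip: powr_add)
    finally show "(\<integral>\<^sup>+z. ennreal (r powr (h + s - 1) * exp (- (r * (e + (norm (z - x))\<^sup>2)))) \<partial>lborel)
       = ennreal (pi powr h * (r powr (s - 1) * exp (- (r * e))))" .
  qed
  also have "\<dots> = ennreal (pi powr h * (Gamma s * e powr (- s)))"
    using s e G by (subst nn_integral_ennreal_cmult) (auto simp: nn_integral_gamma simp flip: ennreal_mult)
  also have "\<dots> = ennreal (Gamma (h + s)) * ennreal (pi powr h * Gamma s / Gamma (h + s) * e powr (- s))"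
    using G by (simp flip: ennreal_mult)
  finally show ?thesis
    using G by (subst (asm) ennreal_mult_cancel_left) auto
qed

text \<open>Writing \<open>1 - (1 + v) powr (- b)\<close> as the integral of
  \<open>b * (1 + w) powr (- b - 1)\<close> over \<open>w\<close> from 0 to \<open>v\<close> and
  exchanging the order leaves an elementary power integral in \<open>v\<close> over
  \<open>v \<ge> w\<close>, then a Beta integral in \<open>w\<close>. This is the value that the
  regularized operator approaches.\<close>

lemma nn_integral_power_diff:
  assumes s: "0 < s" "s < 1" and b: "0 < b"
  shows "(\<integral>\<^sup>+v. ennreal (v powr (- s - 1) * (1 - (1 + v) powr (- b))) \<partial>pos_lborel)
           = ennreal (Gamma (1 - s) * Gamma (b + s) / (s * Gamma b))"
proof -
  have G: "0 < Gamma (1 - s)" "0 < Gamma (b + s)" "0 < Gamma b" "Gamma (1 + b) = b * Gamma b"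
    using s b Gamma_plus1[of b] nonpos_Ints_nonpos[of b]
    by (auto intro!: Gamma_real_pos simp: add.commute)
  define f where "f v w = (if w \<le> v then v powr (- s - 1) * (b * (1 + w) powr (- b - 1)) else 0)" for v w :: real
  have [measurable]: "(\<lambda>(v, w). f v w) \<in> borel_measurable (borel \<Otimes>\<^sub>M borel)"
    unfolding f_def by measurable
  have "(\<integral>\<^sup>+v. ennreal (v powr (- s - 1) * (1 - (1 + v) powr (- b))) \<partial>pos_lborel)
      = (\<integral>\<^sup>+v. \<integral>\<^sup>+w. ennreal (f v w) \<partial>pos_lborel \<partial>pos_lborel)"
  proof (rule nn_integral_pos_cong)
    fix v :: real assume v: "0 < v"
    have "(\<integral>\<^sup>+w. ennreal (f v w) \<partial>pos_lborel) = (\<integral>\<^sup>+w. indicator {0<..} w * ennreal (f v w) \<partial>lborel)"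
      by (rule nn_integral_pos_lborel) auto
    also have "\<dots> = (\<integral>\<^sup>+w. ennreal (v powr (- s - 1) * (b * (1 + w) powr (- b - 1))) * indicator {0..v} w \<partial>lborel)"
      by (rule nn_integral_cong_AE, rule AE_mp[OF AE_lborel_singleton[of 0]], rule AE_I2)
        (auto simp: f_def indicator_def)
    also have "\<dots> = ennreal (v powr (- s - 1) * - ((1 + v) powr (- b)) - v powr (- s - 1) * - ((1 + 0) powr (- b)))"
    proof (rule nn_integral_FTC_Icc)
      fix w :: real assume "w \<in> {0..v}"
      then show "((\<lambda>w. v powr (- s - 1) * - ((1 + w) powr (- b))) has_real_derivative
          v powr (- s - 1) * (b * (1 + w) powr (- b - 1))) (at w)"
        by (auto intro!: derivative_eq_intros)
    qed (use v b in auto)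
    also have "\<dots> = ennreal (v powr (- s - 1) * (1 - (1 + v) powr (- b)))"
      by (simp add: algebra_simps)
    finally show "ennreal (v powr (- s - 1) * (1 - (1 + v) powr (- b))) = (\<integral>\<^sup>+w. ennreal (f v w) \<partial>pos_lborel)"
      by (rule sym)
  qed
  also have "\<dots> = (\<integral>\<^sup>+w. \<integral>\<^sup>+v. ennreal (f v w) \<partial>pos_lborel \<partial>pos_lborel)"
    by (rule nn_integral_pos_swap[symmetric]) (auto simp: sigma_finite_pos_lborel)
  \<comment> \<open>The exponents are left unsimplified to match the Beta integral with parameters
    \<open>1 - s\<close> and \<open>b + s\<close> and both scales equal to 1.\<close>
  also have "\<dots> = (\<integral>\<^sup>+w. ennreal (b / s * (w powr ((1 - s) - 1) * (1 + 1 * w) powr (- (1 - s) - (b + s)))) \<partial>pos_lborel)"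
  proof (rule nn_integral_pos_cong)
    fix w :: real assume w: "0 < w"
    have "(\<integral>\<^sup>+v. ennreal (f v w) \<partial>pos_lborel) = (\<integral>\<^sup>+v. indicator {0<..} v * ennreal (f v w) \<partial>lborel)"
      by (rule nn_integral_pos_lborel) auto
    also have "\<dots> = (\<integral>\<^sup>+v. ennreal (v powr (- s - 1) * (b * (1 + w) powr (- b - 1))) * indicator {w..} v \<partial>lborel)"
      using w by (intro nn_integral_cong) (auto simp: f_def indicator_def)
    also have "\<dots> = ennreal (0 - (- (w powr (- s)) / s * (b * (1 + w) powr (- b - 1))))"
    proof (rule nn_integral_FTC_atLeast[where F = "\<lambda>v. - (v powr (- s)) / s * (b * (1 + w) powr (- b - 1))"])
      fix v :: real assume "w \<le> v"
      then show "((\<lambda>v. - (v powr (- s)) / s * (b * (1 + w) powr (- b - 1))) has_real_derivative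
          v powr (- s - 1) * (b * (1 + w) powr (- b - 1))) (at v)"
        using w s by (auto intro!: derivative_eq_intros)
    next
      have "((\<lambda>v::real. v powr (- s)) \<longlongrightarrow> 0) at_top"
        using s by (intro tendsto_neg_powr filterlim_ident) auto
      from tendsto_mult_left_zero[OF this, of "- (b * (1 + w) powr (- b - 1)) / s"]
      show "((\<lambda>v. - (v powr (- s)) / s * (b * (1 + w) powr (- b - 1))) \<longlongrightarrow> 0) at_top"
        by (simp add: mult_ac)
    qed (use w b in auto)
    also have "0 - (- (w powr (- s)) / s * (b * (1 + w) powr (- b - 1)))
        = b / s * (w powr ((1 - s) - 1) * (1 + 1 * w) powr (- (1 - s) - (b + s)))"
    proof -
      have "(1 - s) - 1 = - s" "- (1 - s) - (b + s) = - b - 1" by auto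
      then show ?thesis by (simp only:) simp
    qed
    finally show "(\<integral>\<^sup>+v. ennreal (f v w) \<partial>pos_lborel) = ennreal \<dots>" .
  qed
  also have "\<dots> = ennreal (b / s * (Gamma (1 - s) * Gamma (b + s) / Gamma (1 - s + (b + s)) * 1 powr (- (1 - s)) * 1 powr (- (b + s))))"
    using s b by (subst nn_integral_ennreal_cmult, simp, simp, subst nn_integral_beta)
      (simp_all only: ennreal_mult'[symmetric] divide_nonneg_nonneg less_imp_le zero_less_one add_pos_pos diff_gt_0_iff_gt)
  also have "b / s * (Gamma (1 - s) * Gamma (b + s) / Gamma (1 - s + (b + s)) * 1 powr (- (1 - s)) * 1 powr (- (b + s)))
     = Gamma (1 - s) * Gamma (b + s) / (s * Gamma b)"
    using G b s by simp
  finally show ?thesis .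
qed

text \<open>Over the common denominator \<open>1 + v\<close>, the base on the left becomes
  \<open>(e + (e + \<rho>) * v) / (1 + v)\<close>, whose numerator is at least
  \<open>e + \<rho> * v\<close>; the remaining power of \<open>1 + v\<close> has exponent
  \<open>a + s - h\<close>, which is not positive. This gives the sign of the integrand to which
  Fatou's lemma is applied.\<close>

lemma riesz_integrand_le:
  fixes a s e \<rho> v h :: real
  assumes "0 < a + s" "0 < e" "0 \<le> \<rho>" "0 < v" "a + s \<le> h"
  shows "(1 + v) powr (- h) * (e + \<rho> * (v / (1 + v))) powr (- (a + s)) \<le> (e + \<rho> * v) powr (- (a + s))"
proof -
  define q where "q = a + s"
  have eq: "e + \<rho> * (v / (1 + v)) = (e + (e + \<rho>) * v) / (1 + v)"
    using assms by (simp add: field_simps)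
  have p: "0 < e + \<rho> * v" "e + \<rho> * v \<le> e + (e + \<rho>) * v"
    using assms by (auto simp: algebra_simps add_pos_nonneg)
  have "(1 + v) powr (- h) * (e + \<rho> * (v / (1 + v))) powr (- q)
     = (1 + v) powr (q - h) * (e + (e + \<rho>) * v) powr (- q)"
    unfolding eq using assms p by (simp add: powr_divide powr_minus powr_diff divide_simps)
  also have "\<dots> \<le> 1 * (e + \<rho> * v) powr (- q)"
  proof (rule mult_mono)
    show "(1 + v) powr (q - h) \<le> 1"
      using assms powr_mono[of "q - h" 0 "1 + v"] by (simp add: q_def)
    show "(e + (e + \<rho>) * v) powr (- q) \<le> (e + \<rho> * v) powr (- q)"
      using assms p by (intro powr_mono2') (auto simp: q_def)
  qed auto
  finally show ?thesis by (simp add: q_def)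
qed

text \<open>Dropping the \<open>x\<close>-dependent part of the base leaves a Beta integral with
  parameters \<open>a\<close> and \<open>h - a\<close>, finite since \<open>a < h\<close>. All later
  integrability claims are comparisons with this one or with
  \<open>integrable_kernel\<close>.\<close>

lemma integrable_riesz:
  fixes x :: "'a::euclidean_space"
  assumes a: "0 < a" "a < real DIM('a) / 2" and s: "0 < s" and e: "0 < e"
  shows "integrable lborel (\<lambda>z. norm z powr (- 2 * a) * (e + (norm (x - z))\<^sup>2) powr (- (real DIM('a) / 2 + s)))"
proof (rule integrableI_nonneg)
  define h where "h = real DIM('a) / 2"
  have "(\<integral>\<^sup>+v. ennreal (v powr (a - 1) * ((1 + v) powr (- h) *
              (e + (norm x)\<^sup>2 * (v / (1 + v))) powr (- (a + s)))) \<partial>pos_lborel)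
     \<le> (\<integral>\<^sup>+v. ennreal (e powr (- (a + s)) * (v powr (a - 1) * (1 + 1 * v) powr (- a - (h - a)))) \<partial>pos_lborel)"
  proof (intro nn_integral_pos_mono ennreal_leI)
    fix v :: real assume "0 < v"
    then have "(e + (norm x)\<^sup>2 * (v / (1 + v))) powr (- (a + s)) \<le> e powr (- (a + s))"
      using e a s by (intro powr_mono2') auto
    then have "v powr (a - 1) * ((1 + v) powr (- h) * (e + (norm x)\<^sup>2 * (v / (1 + v))) powr (- (a + s)))
       \<le> v powr (a - 1) * ((1 + v) powr (- h) * e powr (- (a + s)))"
      by (intro mult_left_mono) auto
    also have "\<dots> = e powr (- (a + s)) * (v powr (a - 1) * (1 + 1 * v) powr (- a - (h - a)))"
      by simp
    finally show "v powr (a - 1) * ((1 + v) powr (- h) * (e + (norm x)\<^sup>2 * (v / (1 + v))) powr (- (a + s)))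
       \<le> e powr (- (a + s)) * (v powr (a - 1) * (1 + 1 * v) powr (- a - (h - a)))" .
  qed
  also have "\<dots> < \<infinity>"
    using a nn_integral_beta[of a "h - a" 1 1]
    by (subst nn_integral_ennreal_cmult) (auto simp: h_def ennreal_mult_less_top)
  finally show "(\<integral>\<^sup>+z. ennreal (norm z powr (- 2 * a) * (e + (norm (x - z))\<^sup>2) powr (- (real DIM('a) / 2 + s))) \<partial>lborel) < \<infinity>"
    unfolding nn_integral_riesz[OF a(1) s e] by (simp add: ennreal_mult_less_top h_def)
qed auto

lemma integrable_kernel:
  fixes x :: "'a::euclidean_space"
  assumes "0 < s" "0 < e"
  shows "integrable lborel (\<lambda>z. (e + (norm (z - x))\<^sup>2) powr (- (real DIM('a) / 2 + s)))"
proof (rule integrableI_nonneg)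
  show "(\<integral>\<^sup>+z. ennreal ((e + (norm (z - x))\<^sup>2) powr (- (real DIM('a) / 2 + s))) \<partial>lborel) < \<infinity>"
    unfolding nn_integral_kernel[OF assms] by simp
qed auto

text \<open>The term with \<open>norm x powr (- 2 * a)\<close> is explicit, a multiple of
  \<open>e powr (- s)\<close>. It is expanded back into a Beta integral with scale
  \<open>(norm x)\<^sup>2\<close>, so that both terms carry the same constant and the same weight
  \<open>v powr (a - 1)\<close> and can be subtracted pointwise.\<close>

lemma regularized_difference:
  fixes x :: "'a::euclidean_space"
  assumes a: "0 < a" and s: "0 < s" and e: "0 < e" and x: "x \<noteq> 0"
    and h: "a + s \<le> real DIM('a) / 2"
  defines "h \<equiv> real DIM('a) / 2"
  shows "ennreal (\<integral>z. (norm x powr (- 2 * a) - norm z powr (- 2 * a)) * (e + (norm (x - z))\<^sup>2) powr (- (h + s)) \<partial>lborel)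
    = ennreal (pi powr h * Gamma (a + s) / (Gamma a * Gamma (h + s))) *
      (\<integral>\<^sup>+v. ennreal (v powr (a - 1) * ((e + (norm x)\<^sup>2 * v) powr (- (a + s)) -
         (1 + v) powr (- h) * (e + (norm x)\<^sup>2 * (v / (1 + v))) powr (- (a + s)))) \<partial>pos_lborel)"
proof -
  define \<rho> where "\<rho> = (norm x)\<^sup>2"
  define K where "K = pi powr h * Gamma (a + s) / (Gamma a * Gamma (h + s))"
  define f1 where "f1 v = v powr (a - 1) * (e + \<rho> * v) powr (- (a + s))" for v
  define f2 where "f2 v = v powr (a - 1) * ((1 + v) powr (- h) * (e + \<rho> * (v / (1 + v))) powr (- (a + s)))" for v
  have [measurable]: "f1 \<in> borel_measurable borel" "f2 \<in> borel_measurable borel"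
    unfolding f1_def f2_def by measurable
  have hpos: "0 < h" by (simp add: h_def)
  have G: "0 < Gamma a" "0 < Gamma s" "0 < Gamma (a + s)" "0 < Gamma (h + s)"
    using a s hpos by (auto intro!: Gamma_real_pos)
  have \<rho>: "0 < \<rho>" using x by (simp add: \<rho>_def)
  have K: "0 < K" using G by (simp add: K_def)
  have nf1: "(\<integral>\<^sup>+v. ennreal (f1 v) \<partial>pos_lborel) = ennreal (Gamma a * Gamma s / Gamma (a + s) * \<rho> powr (- a) * e powr (- s))"
    using nn_integral_beta[OF a s e \<rho>] by (simp add: f1_def)
  have f12: "f2 v \<le> f1 v" if "0 < v" for v
    unfolding f1_def f2_def using riesz_integrand_le[of a s e \<rho> v h] that a s e \<rho> assms(5)
    by (intro mult_left_mono) (auto simp: h_def)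
  have f0: "0 \<le> f1 v" "0 \<le> f2 v" for v by (auto simp: f1_def f2_def)
  have i1: "integrable pos_lborel f1"
    by (rule integrableI_nonneg) (auto simp: nf1 f0)
  have i2: "integrable pos_lborel f2"
    by (rule Bochner_Integration.integrable_bound[OF i1])
       (simp, use AE_pos_lborel in eventually_elim, use f0 f12 in auto)
  \<comment> \<open>The constant \<open>K\<close> comes from the Riesz integral; the factors
    \<open>Gamma a\<close> and \<open>Gamma (a + s)\<close> of the Beta integral cancel against it
    and leave the mass of the kernel.\<close>
  have I1: "norm x powr (- 2 * a) * (\<integral>z. (e + (norm (x - z))\<^sup>2) powr (- (h + s)) \<partial>lborel) = K * (\<integral>v. f1 v \<partial>pos_lborel)"
  proof -
    have "(\<integral>z. (e + (norm (x - z))\<^sup>2) powr (- (h + s)) \<partial>lborel) = pi powr h * Gamma s / Gamma (h + s) * e powr (- s)"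
      using nn_integral_kernel[OF s e, of x] G
      by (subst integral_eq_nn_integral) (auto simp: norm_minus_commute h_def)
    moreover have "(\<integral>v. f1 v \<partial>pos_lborel) = Gamma a * Gamma s / Gamma (a + s) * \<rho> powr (- a) * e powr (- s)"
      using G by (subst integral_eq_nn_integral) (auto simp: f0 nf1)
    moreover have "\<rho> powr (- a) = norm x powr (- 2 * a)"
      using x by (simp add: \<rho>_def powr_powr flip: powr_numeral)
    ultimately show ?thesis using G by (simp add: K_def)
  qed
  have I2: "(\<integral>z. norm z powr (- 2 * a) * (e + (norm (x - z))\<^sup>2) powr (- (h + s)) \<partial>lborel) = K * (\<integral>v. f2 v \<partial>pos_lborel)"
    using nn_integral_riesz[OF a s e, of x] K f0
    by (subst (1 2) integral_eq_nn_integral) (auto simp: h_def K_def f2_def \<rho>_def enn2real_mult)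
  have J1: "integrable lborel (\<lambda>z. (e + (norm (x - z))\<^sup>2) powr (- (h + s)))"
    using integrable_kernel[OF s e, of x] by (simp add: norm_minus_commute h_def)
  have J2: "integrable lborel (\<lambda>z. norm z powr (- 2 * a) * (e + (norm (x - z))\<^sup>2) powr (- (h + s)))"
    using integrable_riesz[OF a _ s e, of x] assms(5) s by (simp add: h_def)
  have "(\<integral>z. (norm x powr (- 2 * a) - norm z powr (- 2 * a)) * (e + (norm (x - z))\<^sup>2) powr (- (h + s)) \<partial>lborel)
     = (\<integral>z. norm x powr (- 2 * a) * (e + (norm (x - z))\<^sup>2) powr (- (h + s)) -
            norm z powr (- 2 * a) * (e + (norm (x - z))\<^sup>2) powr (- (h + s)) \<partial>lborel)"
    by (simp add: left_diff_distrib)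
  also have "\<dots> = K * (\<integral>v. f1 v \<partial>pos_lborel) - K * (\<integral>v. f2 v \<partial>pos_lborel)"
    using J1 J2 I1 I2 by (subst Bochner_Integration.integral_diff) auto
  also have "\<dots> = K * (\<integral>v. f1 v - f2 v \<partial>pos_lborel)"
    using i1 i2 by (simp add: right_diff_distrib)
  finally have "ennreal (\<integral>z. (norm x powr (- 2 * a) - norm z powr (- 2 * a)) * (e + (norm (x - z))\<^sup>2) powr (- (h + s)) \<partial>lborel)
     = ennreal K * ennreal (\<integral>v. f1 v - f2 v \<partial>pos_lborel)"
    using K by (simp add: ennreal_mult')
  also have "ennreal (\<integral>v. f1 v - f2 v \<partial>pos_lborel) = (\<integral>\<^sup>+v. ennreal (f1 v - f2 v) \<partial>pos_lborel)"
    by (rule nn_integral_eq_integral[symmetric])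
       (use i1 i2 in simp, use AE_pos_lborel in eventually_elim, use f12 in auto)
  finally show ?thesis
    by (simp add: K_def f1_def f2_def \<rho>_def right_diff_distrib)
qed

text \<open>At \<open>e = 0\<close> the two powers share the factor
  \<open>(\<rho> * v) powr (- (a + s))\<close>, and what remains is the integrand of
  \<open>nn_integral_power_diff\<close> with \<open>b = h - s - a\<close>. That the limit
  \<open>A\<close> exists is a hypothesis here, established separately through second
  differences.\<close>

lemma regularized_limit_ge:
  fixes x :: "'a::euclidean_space"
  assumes a: "0 < a" and s: "0 < s" "s < 1" and x: "x \<noteq> 0"
    and h: "a + s < real DIM('a) / 2"
  defines "h \<equiv> real DIM('a) / 2"
  assumes lim: "(\<lambda>n. \<integral>z. (norm x powr (- 2 * a) - norm z powr (- 2 * a)) *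
      (1 / real (Suc n) + (norm (x - z))\<^sup>2) powr (- (h + s)) \<partial>lborel) \<longlonglongrightarrow> A"
  shows "A \<ge> pi powr h * Gamma (a + s) / (Gamma a * Gamma (h + s)) *
      (Gamma (1 - s) * Gamma (h - a) / (s * Gamma (h - s - a))) * norm x powr (- 2 * a - 2 * s)"
proof -
  define \<rho> where "\<rho> = (norm x)\<^sup>2"
  define b where "b = h - s - a"
  define K where "K = pi powr h * Gamma (a + s) / (Gamma a * Gamma (h + s))"
  define I where "I = (\<lambda>e. \<integral>z. (norm x powr (- 2 * a) - norm z powr (- 2 * a)) *
      (e + (norm (x - z))\<^sup>2) powr (- (h + s)) \<partial>lborel)"
  define H where "H e v = v powr (a - 1) * ((e + \<rho> * v) powr (- (a + s)) -
         (1 + v) powr (- h) * (e + \<rho> * (v / (1 + v))) powr (- (a + s)))" for e v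
  have [measurable]: "(\<lambda>v. H e v) \<in> borel_measurable borel" for e
    unfolding H_def by measurable
  have b: "0 < b" using h by (simp add: b_def h_def)
  have hpos: "0 < h" by (simp add: h_def)
  have G: "0 < Gamma a" "0 < Gamma s" "0 < Gamma (1 - s)" "0 < Gamma (a + s)" "0 < Gamma (h + s)"
      "0 < Gamma b" "0 < Gamma (h - a)"
    using a s hpos b by (auto intro!: Gamma_real_pos simp: b_def)
  have K: "0 < K" using G by (simp add: K_def)
  have \<rho>: "0 < \<rho>" "\<rho> powr (- (a + s)) = norm x powr (- 2 * a - 2 * s)"
    using x by (auto simp: \<rho>_def powr_powr algebra_simps simp flip: powr_numeral)
  have I: "ennreal (I e) = (\<integral>\<^sup>+v. ennreal (K * H e v) \<partial>pos_lborel)" if "0 < e" for e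
    using regularized_difference[OF a s(1) that x] h K unfolding I_def H_def K_def \<rho>_def h_def
    by (subst nn_integral_ennreal_cmult) auto
  have "ennreal (K * (\<rho> powr (- (a + s)) * (Gamma (1 - s) * Gamma (b + s) / (s * Gamma b))))
     = ennreal (K * \<rho> powr (- (a + s))) * (\<integral>\<^sup>+v. ennreal (v powr (- s - 1) * (1 - (1 + v) powr (- b))) \<partial>pos_lborel)"
    unfolding nn_integral_power_diff[OF s b] using K s b
    by (subst ennreal_mult'[symmetric]) (auto simp: mult.assoc)
  also have "\<dots> = (\<integral>\<^sup>+v. ennreal (K * \<rho> powr (- (a + s)) * (v powr (- s - 1) * (1 - (1 + v) powr (- b)))) \<partial>pos_lborel)"
    using K by (subst nn_integral_ennreal_cmult) auto
  also have "\<dots> = (\<integral>\<^sup>+v. liminf (\<lambda>n. ennreal (K * H (1 / real (Suc n)) v)) \<partial>pos_lborel)"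
  proof (rule nn_integral_pos_cong)
    fix v :: real assume v: "0 < v"
    have "(\<lambda>n. H (1 / real (Suc n)) v) \<longlonglongrightarrow> H 0 v"
      unfolding H_def using v \<rho> a s
      by (intro tendsto_intros tendsto_powr LIMSEQ_Suc[OF lim_1_over_n]) auto
    then have "(\<lambda>n. ennreal (K * H (1 / real (Suc n)) v)) \<longlonglongrightarrow> ennreal (K * H 0 v)"
      by (intro tendsto_ennrealI tendsto_intros)
    moreover have "H 0 v = \<rho> powr (- (a + s)) * (v powr (- s - 1) * (1 - (1 + v) powr (- b)))"
    proof -
      have 1: "(\<rho> * (v / (1 + v))) powr (- (a + s)) = \<rho> powr (- (a + s)) * v powr (- (a + s)) * (1 + v) powr (a + s)"
        using v \<rho> by (simp add: powr_mult powr_divide powr_minus powr_diff powr_add divide_simps)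
      have 2: "(\<rho> * v) powr (- (a + s)) = \<rho> powr (- (a + s)) * v powr (- (a + s))"
        using v \<rho> by (simp add: powr_mult)
      have "H 0 v = \<rho> powr (- (a + s)) * ((v powr (a - 1) * v powr (- (a + s))) *
          (1 - (1 + v) powr (- h) * (1 + v) powr (a + s)))"
        unfolding H_def add_0 1 2 by (simp add: algebra_simps)
      also have "v powr (a - 1) * v powr (- (a + s)) = v powr (- s - 1)"
        unfolding powr_add[symmetric] by (rule arg_cong[where f = "(powr) v"]) simp
      also have "(1 + v) powr (- h) * (1 + v) powr (a + s) = (1 + v) powr (- b)"
        by (simp add: b_def algebra_simps flip: powr_add)
      finally show ?thesis .
    qed
    ultimately show "ennreal (K * \<rho> powr (- (a + s)) * (v powr (- s - 1) * (1 - (1 + v) powr (- b)))) =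
        liminf (\<lambda>n. ennreal (K * H (1 / real (Suc n)) v))"
      by (metis lim_imp_Liminf sequentially_bot mult.assoc)
  qed
  also have "\<dots> \<le> liminf (\<lambda>n. \<integral>\<^sup>+v. ennreal (K * H (1 / real (Suc n)) v) \<partial>pos_lborel)"
    by (rule nn_integral_liminf) auto
  also have "\<dots> = liminf (\<lambda>n. ennreal (I (1 / real (Suc n))))"
    by (simp add: I)
  also have "\<dots> = ennreal A"
    using lim by (intro lim_imp_Liminf tendsto_ennrealI) (auto simp: I_def)
  finally have "ennreal (K * (\<rho> powr (- (a + s)) * (Gamma (1 - s) * Gamma (b + s) / (s * Gamma b)))) \<le> ennreal A" .
  \<comment> \<open>Since \<open>ennreal A\<close> is 0 for negative \<open>A\<close>, the
    inequality returns to the reals only because its left side is strictly positive.\<close>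
  moreover have "0 < K * (\<rho> powr (- (a + s)) * (Gamma (1 - s) * Gamma (b + s) / (s * Gamma b)))"
    using K \<rho> G s by (auto simp: b_def intro!: mult_pos_pos divide_pos_pos)
  ultimately have "K * (\<rho> powr (- (a + s)) * (Gamma (1 - s) * Gamma (b + s) / (s * Gamma b))) \<le> A"
    by (smt (verit) ennreal_le_iff ennreal_neg ennreal_0 ennreal_less_zero_iff not_le)
  then show ?thesis unfolding \<rho>(2) by (simp add: K_def b_def mult_ac)
qed

subsection \<open>Principal values and second differences\<close>

text \<open>First-order Taylor expansion, to be applied with \<open>w\<close> a squared norm. The
  range \<open>w0 / 4 \<le> w\<close> corresponds to points of norm at least half that of the
  centre.\<close>

lemma powr_taylor_remainder:
  fixes a w0 :: real
  assumes a: "0 < a" and w0: "0 < w0"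
  obtains M where "0 \<le> M" and
    "\<And>w. w0 / 4 \<le> w \<Longrightarrow> \<bar>w powr (- a) - w0 powr (- a) + a * w0 powr (- a - 1) * (w - w0)\<bar> \<le> M * (w - w0)\<^sup>2"
proof
  \<comment> \<open>The second derivative is decreasing, so its bound is its value at the left end
    \<open>w0 / 4\<close>.\<close>
  define M where "M = a * (a + 1) * (w0 / 4) powr (- a - 2)"
  show "0 \<le> M" using a by (simp add: M_def)
  define f where "f = (\<lambda>(i::nat) (w::real). if i = 0 then w powr (- a) else if i = 1 then - a * w powr (- a - 1)
      else a * (a + 1) * w powr (- a - 2))"
  fix w assume w: "w0 / 4 \<le> w"
  have "norm (f 0 w - (\<Sum>i\<le>1. f i w0 * (w - w0) ^ i / fact i)) \<le> M * norm (w - w0) ^ (Suc 1) / fact 1"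
  proof (rule field_Taylor[of "{w0 / 4..}"])
    fix i :: nat and x :: real assume x: "x \<in> {w0 / 4..}" and i: "i \<le> 1"
    then have "0 < x" using w0 by auto
    then have "(f i has_real_derivative f (Suc i) x) (at x)"
      using i by (cases i) (auto simp: f_def algebra_simps intro!: derivative_eq_intros)
    then show "(f i has_real_derivative f (Suc i) x) (at x within {w0 / 4..})"
      by (rule has_field_derivative_at_within)
  next
    fix x :: real assume "x \<in> {w0 / 4..}"
    then have "x powr (- a - 2) \<le> (w0 / 4) powr (- a - 2)"
      using w0 a by (intro powr_mono2') auto
    then show "norm (f (Suc 1) x) \<le> M"
      using a by (simp add: f_def M_def abs_mult)
  qed (use w w0 in auto)
  moreover have "f 0 w - (\<Sum>i\<le>1. f i w0 * (w - w0) ^ i / fact i)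
      = w powr (- a) - w0 powr (- a) + a * w0 powr (- a - 1) * (w - w0)"
    by (simp add: f_def)
  ultimately show "\<bar>w powr (- a) - w0 powr (- a) + a * w0 powr (- a - 1) * (w - w0)\<bar> \<le> M * (w - w0)\<^sup>2"
    by (simp add: power2_eq_square)
qed

text \<open>The sign is the one of the fractional Laplacian, opposite to that of the usual second
  difference quotient.\<close>

definition second_difference :: "('a::ab_group_add \<Rightarrow> real) \<Rightarrow> 'a \<Rightarrow> 'a \<Rightarrow> real" where
  "second_difference u x y = 2 * u x - u (x + y) - u (x - y)"

text \<open>The power is expanded as a function of the squared norm alone. By the parallelogram law
  the linear terms at \<open>x + y\<close> and \<open>x - y\<close> add up to a multiple of
  \<open>(norm y)\<^sup>2\<close>, so no derivatives in several variables enter.\<close>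

lemma second_difference_powr_le:
  fixes x :: "'a::real_inner"
  assumes a: "0 < a" and x: "x \<noteq> 0"
  obtains M where "0 \<le> M" and
    "\<And>y. norm y \<le> norm x / 2 \<Longrightarrow> \<bar>second_difference (\<lambda>z. norm z powr (- 2 * a)) x y\<bar> \<le> M * (norm y)\<^sup>2"
proof -
  define \<rho> where "\<rho> = (norm x)\<^sup>2"
  have \<rho>: "0 < \<rho>" using x by (simp add: \<rho>_def)
  obtain M where M: "0 \<le> M"
    "\<And>w. \<rho> / 4 \<le> w \<Longrightarrow> \<bar>w powr (- a) - \<rho> powr (- a) + a * \<rho> powr (- a - 1) * (w - \<rho>)\<bar> \<le> M * (w - \<rho>)\<^sup>2"
    using powr_taylor_remainder[OF a \<rho>] by metis
  define c where "c = a * \<rho> powr (- a - 1)"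
  have c: "0 \<le> c" using a by (simp add: c_def)
  show thesis
  proof
    show "0 \<le> 2 * c + 2 * M * (3 * norm x)\<^sup>2" using c M by simp
    fix y :: 'a assume y: "norm y \<le> norm x / 2"
    \<comment> \<open>Factoring a difference of squares bounds
      \<open>\<bar>(norm (x + z))\<^sup>2 - \<rho>\<bar>\<close> by
      \<open>3 * norm x * norm z\<close>, which is the origin of the constant 3.\<close>
    have *: "\<bar>norm (x + z) powr (- 2 * a) - norm x powr (- 2 * a) + c * ((norm (x + z))\<^sup>2 - \<rho>)\<bar> \<le> M * (3 * norm x)\<^sup>2 * (norm z)\<^sup>2"
      if z: "norm z \<le> norm x / 2" for z
    proof -
      have n: "norm x / 2 \<le> norm (x + z)" "\<bar>norm (x + z) - norm x\<bar> \<le> norm z" "norm (x + z) \<le> 2 * norm x"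
        using z norm_triangle_ineq[of x z] norm_triangle_ineq4[of "x + z" z] by auto
      have "(norm x / 2)\<^sup>2 \<le> (norm (x + z))\<^sup>2" using n by (intro power_mono) auto
      then have 1: "\<rho> / 4 \<le> (norm (x + z))\<^sup>2" by (simp add: \<rho>_def power_divide)
      have "(norm (x + z))\<^sup>2 - \<rho> = (norm (x + z) - norm x) * (norm (x + z) + norm x)"
        by (simp add: \<rho>_def power2_eq_square algebra_simps)
      then have "\<bar>(norm (x + z))\<^sup>2 - \<rho>\<bar> \<le> norm z * (3 * norm x)"
        using n by (simp add: abs_mult) (intro mult_mono, auto)
      then have "\<bar>(norm (x + z))\<^sup>2 - \<rho>\<bar>\<^sup>2 \<le> (norm z * (3 * norm x))\<^sup>2"
        by (intro power_mono) auto
      then have 2: "M * ((norm (x + z))\<^sup>2 - \<rho>)\<^sup>2 \<le> M * ((3 * norm x)\<^sup>2 * (norm z)\<^sup>2)"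
        using M by (intro mult_left_mono) (auto simp: power_mult_distrib mult.commute)
      have 3: "((norm (x + z))\<^sup>2) powr (- a) = norm (x + z) powr (- 2 * a)" "\<rho> powr (- a) = norm x powr (- 2 * a)"
        using x n(1) by (auto simp: \<rho>_def powr_powr simp flip: powr_numeral)
      show ?thesis using M(2)[OF 1] 2 unfolding 3 c_def by (simp add: mult.assoc)
    qed
    have "(norm (x + y))\<^sup>2 - \<rho> + ((norm (x + - y))\<^sup>2 - \<rho>) = 2 * (norm y)\<^sup>2"
      unfolding \<rho>_def power2_norm_eq_inner by (simp add: algebra_simps inner_commute)
    then have "c * ((norm (x + y))\<^sup>2 - \<rho>) + c * ((norm (x + - y))\<^sup>2 - \<rho>) = 2 * c * (norm y)\<^sup>2"
      by (metis (no_types, opaque_lifting) distrib_left mult.assoc mult.left_commute)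
    moreover have "0 \<le> c * (norm y)\<^sup>2" using c by simp
    ultimately show "\<bar>second_difference (\<lambda>z. norm z powr (- 2 * a)) x y\<bar>
        \<le> (2 * c + 2 * M * (3 * norm x)\<^sup>2) * (norm y)\<^sup>2"
      using *[of y] *[of "- y"] y unfolding second_difference_def distrib_right
      by (simp add: mult.assoc)
  qed
qed

text \<open>The cases of interest are \<open>c = 1\<close> and \<open>c = -1\<close>, the
  substitutions \<open>z = x + y\<close> and \<open>z = x - y\<close>.\<close>

lemma lborel_isometry:
  fixes x :: "'a::euclidean_space"
  assumes "\<bar>c\<bar> = 1"
  shows "distr lborel borel (\<lambda>y. x + c *\<^sub>R y) = lborel"
proof -
  have "c \<noteq> 0" using assms by auto
  from lborel_affine[OF this, of x] show ?thesis using assms by (simp add: density_1)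
qed

lemma integrable_isometry:
  fixes f :: "'a::euclidean_space \<Rightarrow> real"
  assumes "\<bar>c\<bar> = 1" "integrable lborel f"
  shows "integrable lborel (\<lambda>y. f (x + c *\<^sub>R y))"
proof -
  have "integrable (distr lborel borel (\<lambda>y. x + c *\<^sub>R y)) f"
    using assms by (simp add: lborel_isometry)
  then show ?thesis by (subst (asm) integrable_distr_eq) (use assms(2) in auto)
qed

lemma integral_isometry:
  fixes f :: "'a::euclidean_space \<Rightarrow> real"
  assumes "\<bar>c\<bar> = 1" "integrable lborel f"
  shows "(\<integral>y. f (x + c *\<^sub>R y) \<partial>lborel) = (\<integral>z. f z \<partial>lborel)"
proof -
  have "(\<integral>z. f z \<partial>lborel) = (\<integral>z. f z \<partial>distr lborel borel (\<lambda>y. x + c *\<^sub>R y))"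
    using assms by (simp add: lborel_isometry)
  also have "\<dots> = (\<integral>y. f (x + c *\<^sub>R y) \<partial>lborel)"
    by (rule integral_distr) (use assms(2) in auto)
  finally show ?thesis ..
qed

text \<open>The kernel is radial, so both substitutions give the same value, and their average is
  half the integral of the second difference. The latter tolerates a kernel for which the first
  difference has only a principal value.\<close>

lemma integral_symmetrize:
  fixes x :: "'a::euclidean_space" and u :: "'a \<Rightarrow> real"
  assumes i: "integrable lborel (\<lambda>z. (u x - u z) * k (norm (x - z)))"
  shows "(\<integral>z. (u x - u z) * k (norm (x - z)) \<partial>lborel) =
      (\<integral>y. second_difference u x y * k (norm y) \<partial>lborel) / 2"
proof -
  have 1: "integrable lborel (\<lambda>y. (u x - u (x + y)) * k (norm y))"
      "(\<integral>y. (u x - u (x + y)) * k (norm y) \<partial>lborel) = (\<integral>z. (u x - u z) * k (norm (x - z)) \<partial>lborel)"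
    using integrable_isometry[OF _ i, of 1 x] integral_isometry[OF _ i, of 1 x] by simp_all
  have 2: "integrable lborel (\<lambda>y. (u x - u (x - y)) * k (norm y))"
      "(\<integral>y. (u x - u (x - y)) * k (norm y) \<partial>lborel) = (\<integral>z. (u x - u z) * k (norm (x - z)) \<partial>lborel)"
    using integrable_isometry[OF _ i, of "-1" x] integral_isometry[OF _ i, of "-1" x] by simp_all
  have "(\<integral>y. second_difference u x y * k (norm y) \<partial>lborel)
     = (\<integral>y. (u x - u (x + y)) * k (norm y) + (u x - u (x - y)) * k (norm y) \<partial>lborel)"
    by (simp add: second_difference_def algebra_simps)
  also have "\<dots> = 2 * (\<integral>z. (u x - u z) * k (norm (x - z)) \<partial>lborel)"
    using 1 2 by (subst Bochner_Integration.integral_add) auto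
  finally show ?thesis by simp
qed

text \<open>For \<open>r \<ge> \<epsilon>\<close> one has
  \<open>1 + r\<^sup>2 \<le> (1 + 1 / \<epsilon>\<^sup>2) * r\<^sup>2\<close>. Kernels cut off near
  the singularity are thereby dominated by the regularized kernel with parameter 1.\<close>

lemma truncated_kernel_le:
  fixes q \<epsilon> r :: real
  assumes "0 < q" "0 < \<epsilon>" "\<epsilon> \<le> r"
  shows "r powr (- 2 * q) \<le> (1 + 1 / \<epsilon>\<^sup>2) powr q * (1 + r\<^sup>2) powr (- q)"
proof -
  have r: "0 < r" using assms by simp
  have "1 + r\<^sup>2 \<le> (1 + 1 / \<epsilon>\<^sup>2) * r\<^sup>2"
    using assms power_mono[of \<epsilon> r 2] by (simp add: field_simps)
  then have "((1 + 1 / \<epsilon>\<^sup>2) * r\<^sup>2) powr (- q) \<le> (1 + r\<^sup>2) powr (- q)"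
    using assms r by (intro powr_mono2') (auto simp: add_pos_nonneg)
  then have "(1 + 1 / \<epsilon>\<^sup>2) powr q * ((1 + 1 / \<epsilon>\<^sup>2) powr (- q) * (r\<^sup>2) powr (- q)) \<le> (1 + 1 / \<epsilon>\<^sup>2) powr q * (1 + r\<^sup>2) powr (- q)"
    by (intro mult_left_mono) (auto simp: powr_mult)
  moreover have "(1 + 1 / \<epsilon>\<^sup>2) powr q * (1 + 1 / \<epsilon>\<^sup>2) powr (- q) = 1"
    using assms by (simp add: add_pos_pos less_imp_neq[symmetric] flip: powr_add)
  moreover have "(r\<^sup>2) powr (- q) = r powr (- 2 * q)"
    using r by (simp add: powr_powr flip: powr_numeral)
  ultimately show ?thesis by (simp flip: mult.assoc)
qed

section \<open>Equality of the truncated and the regularized limit\<close>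

context
  fixes a s h :: real and x :: "'a::euclidean_space" and u :: "'a \<Rightarrow> real"
  assumes a: "0 < a" "a < h" and s: "0 < s" "s < 1" and h: "1 \<le> h" "h = real DIM('a) / 2" and x: "x \<noteq> 0"
    and u: "u = (\<lambda>z. norm z powr (- 2 * a))"
begin

lemma integrable_u_kernel: "integrable lborel (\<lambda>z. u z * (1 + (norm (x - z))\<^sup>2) powr (- (h + s)))"
  using integrable_riesz[of a s 1 x] a s h(1) unfolding u h(2) by simp

text \<open>The bound on \<open>k\<close> is one that both approximating kernels satisfy, with
  \<open>C\<close> depending on the approximation parameter.\<close>

lemma integrable_diff_kernel:
  assumes [measurable]: "k \<in> borel_measurable borel" and k: "\<And>r. 0 \<le> r \<Longrightarrow> \<bar>k r\<bar> \<le> C * (1 + r\<^sup>2) powr (- (h + s))"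
  shows "integrable lborel (\<lambda>z. (u x - u z) * k (norm (x - z)))"
proof (rule Bochner_Integration.integrable_bound)
  show "integrable lborel (\<lambda>z. C * (u x * (1 + (norm (x - z))\<^sup>2) powr (- (h + s)) +
      u z * (1 + (norm (x - z))\<^sup>2) powr (- (h + s))))"
    using integrable_u_kernel integrable_kernel[of s 1 x] s unfolding h(2) by (simp add: norm_minus_commute[of _ x])
  have C: "0 \<le> C" using k[of 0] by simp
  have u0: "0 \<le> u z" for z by (simp add: u)
  show "AE z in lborel. norm ((u x - u z) * k (norm (x - z))) \<le>
      norm (C * (u x * (1 + (norm (x - z))\<^sup>2) powr (- (h + s)) + u z * (1 + (norm (x - z))\<^sup>2) powr (- (h + s))))"
  proof (rule AE_I2)
    fix z
    have "norm ((u x - u z) * k (norm (x - z))) \<le> (u x + u z) * (C * (1 + (norm (x - z))\<^sup>2) powr (- (h + s)))"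
      unfolding real_norm_def abs_mult using u0[of x] u0[of z] k[of "norm (x - z)"]
      by (intro mult_mono) auto
    also have "\<dots> = C * (u x * (1 + (norm (x - z))\<^sup>2) powr (- (h + s)) + u z * (1 + (norm (x - z))\<^sup>2) powr (- (h + s)))"
      by (simp add: algebra_simps)
    finally show "norm ((u x - u z) * k (norm (x - z))) \<le>
      norm (C * (u x * (1 + (norm (x - z))\<^sup>2) powr (- (h + s)) + u z * (1 + (norm (x - z))\<^sup>2) powr (- (h + s))))"
      by simp
  qed
qed (simp add: u)

text \<open>Near 0 the quadratic bound leaves \<open>norm y powr (- 2 * (h + s - 1))\<close>, again
  a Riesz integrand: its parameter \<open>h + s - 1\<close> lies strictly between 0 and
  \<open>h\<close> because \<open>1 \<le> h\<close> and \<open>0 < s < 1\<close>. Away from 0 each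
  of the three terms is integrable against the regularized kernel.\<close>

lemma integrable_second_difference:
  "integrable lborel (\<lambda>y. second_difference u x y * norm y powr (- 2 * (h + s)))"
proof -
  define \<delta> where "\<delta> = norm x / 2"
  have \<delta>: "0 < \<delta>" using x by (simp add: \<delta>_def)
  obtain M where M: "0 \<le> M" "\<And>y. norm y \<le> \<delta> \<Longrightarrow> \<bar>second_difference u x y\<bar> \<le> M * (norm y)\<^sup>2"
    using second_difference_powr_le[OF a(1) x] unfolding u \<delta>_def by metis
  define k where "k y = (1 + (norm y)\<^sup>2) powr (- (h + s))" for y :: 'a
  \<comment> \<open>\<open>C1\<close> pays for inserting the factor \<open>k y\<close>, which is
    bounded below on the ball of radius \<open>\<delta>\<close>; \<open>C2\<close> is the constant
    of \<open>truncated_kernel_le\<close> outside it.\<close>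
  define C1 where "C1 = M * (1 + \<delta>\<^sup>2) powr (h + s)"
  define C2 where "C2 = (1 + 1 / \<delta>\<^sup>2) powr (h + s)"
  have iu: "integrable lborel (\<lambda>y. u (x + y) * k y)" "integrable lborel (\<lambda>y. u (x - y) * k y)"
    using integrable_isometry[OF _ integrable_u_kernel, of 1 x] integrable_isometry[OF _ integrable_u_kernel, of "-1" x]
    by (auto simp: k_def)
  have ik: "integrable lborel k"
    using integrable_kernel[of s 1 "0::'a"] s unfolding k_def[abs_def] h(2) by simp
  have i0: "integrable lborel (\<lambda>y. norm y powr (- 2 * (h + s - 1)) * k y)"
    using integrable_riesz[of "h + s - 1" s 1 "0::'a"] s h(1) unfolding k_def h(2) by simp
  have [measurable]: "u \<in> borel_measurable borel" by (simp add: u)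
  show ?thesis
  proof (rule Bochner_Integration.integrable_bound)
    show "integrable lborel (\<lambda>y. C1 * (norm y powr (- 2 * (h + s - 1)) * k y)
        + C2 * (2 * u x * k y + u (x + y) * k y + u (x - y) * k y))"
      using iu ik i0 by simp
    show "AE y in lborel. norm (second_difference u x y * norm y powr (- 2 * (h + s)))
      \<le> norm (C1 * (norm y powr (- 2 * (h + s - 1)) * k y) + C2 * (2 * u x * k y + u (x + y) * k y + u (x - y) * k y))"
    proof (rule AE_I2)
      fix y :: 'a
      have u0: "0 \<le> u z" for z by (simp add: u)
      have k0: "0 \<le> k y" by (simp add: k_def)
      have A0: "0 \<le> C1 * (norm y powr (- 2 * (h + s - 1)) * k y)" using M k0 by (simp add: C1_def)
      have B0: "0 \<le> C2 * (2 * u x * k y + u (x + y) * k y + u (x - y) * k y)" using u0 k0 by (simp add: C2_def)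
      have "\<bar>second_difference u x y\<bar> * norm y powr (- 2 * (h + s))
         \<le> C1 * (norm y powr (- 2 * (h + s - 1)) * k y) + C2 * (2 * u x * k y + u (x + y) * k y + u (x - y) * k y)"
      proof (cases "norm y \<le> \<delta>")
        case True
        have "\<bar>second_difference u x y\<bar> * norm y powr (- 2 * (h + s)) \<le> M * (norm y)\<^sup>2 * norm y powr (- 2 * (h + s))"
          by (intro mult_right_mono M True) auto
        also have "\<dots> = M * norm y powr (- 2 * (h + s - 1))"
        proof (cases "y = 0")
          case False
          then have "(norm y)\<^sup>2 * norm y powr (- 2 * (h + s)) = norm y powr 2 * norm y powr (- 2 * (h + s))"
            by simp
          also have "\<dots> = norm y powr (- 2 * (h + s - 1))"
            by (simp only: powr_add[symmetric]) (simp add: algebra_simps)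
          finally show ?thesis by simp
        qed simp
        also have "\<dots> \<le> M * (norm y powr (- 2 * (h + s - 1)) * ((1 + \<delta>\<^sup>2) powr (h + s) * k y))"
        proof -
          have "(1 + (norm y)\<^sup>2) powr (h + s) \<le> (1 + \<delta>\<^sup>2) powr (h + s)"
            using True s h by (intro powr_mono2 add_left_mono power_mono) auto
          then have "(1 + (norm y)\<^sup>2) powr (h + s) * k y \<le> (1 + \<delta>\<^sup>2) powr (h + s) * k y"
            by (intro mult_right_mono k0)
          moreover have "(1 + (norm y)\<^sup>2) powr (h + s) * k y = 1"
            unfolding k_def powr_add[symmetric] by (simp add: add_pos_nonneg less_imp_neq[symmetric])
          ultimately have "norm y powr (- 2 * (h + s - 1)) * 1 \<le> norm y powr (- 2 * (h + s - 1)) * ((1 + \<delta>\<^sup>2) powr (h + s) * k y)"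
            by (intro mult_left_mono) auto
          then show ?thesis using M by (intro mult_left_mono) auto
        qed
        finally show ?thesis using B0 by (simp add: C1_def mult_ac)
      next
        case False
        have "\<bar>second_difference u x y\<bar> \<le> 2 * u x + u (x + y) + u (x - y)"
          using u0[of x] u0[of "x + y"] u0[of "x - y"] by (simp add: second_difference_def)
        moreover have "norm y powr (- 2 * (h + s)) \<le> C2 * k y"
          unfolding C2_def k_def using False \<delta> s h by (intro truncated_kernel_le) auto
        ultimately have "\<bar>second_difference u x y\<bar> * norm y powr (- 2 * (h + s)) \<le> (2 * u x + u (x + y) + u (x - y)) * (C2 * k y)"
          using u0 by (intro mult_mono) auto
        then show ?thesis using A0 by (simp add: algebra_simps)
      qed
      then show "norm (second_difference u x y * norm y powr (- 2 * (h + s)))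
      \<le> norm (C1 * (norm y powr (- 2 * (h + s - 1)) * k y) + C2 * (2 * u x * k y + u (x + y) * k y + u (x - y) * k y))"
        using A0 B0 by (simp add: abs_mult)
    qed
  qed (simp add: second_difference_def)
qed

text \<open>After symmetrization the truncation merely removes a shrinking ball from the domain of
  an integrable function, which itself serves as the dominating function.\<close>

lemma truncated_limit:
  "((\<lambda>\<epsilon>. \<integral>z. (u x - u z) * (if \<epsilon> \<le> norm (x - z) then norm (x - z) powr (- 2 * (h + s)) else 0) \<partial>lborel) \<longlongrightarrow>
     (\<integral>y. second_difference u x y * norm y powr (- 2 * (h + s)) \<partial>lborel) / 2) (at_right 0)"
proof -
  have [measurable]: "u \<in> borel_measurable borel" by (simp add: u)
  define k where "k \<epsilon> r = (if \<epsilon> \<le> r then r powr (- 2 * (h + s)) else 0)" for \<epsilon> r :: real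
  have [measurable]: "k \<epsilon> \<in> borel_measurable borel" for \<epsilon> unfolding k_def by measurable
  have eq: "(\<integral>z. (u x - u z) * k \<epsilon> (norm (x - z)) \<partial>lborel) = (\<integral>y. second_difference u x y * k \<epsilon> (norm y) \<partial>lborel) / 2"
    if "0 < \<epsilon>" for \<epsilon>
  proof (intro integral_symmetrize integrable_diff_kernel)
    fix r :: real assume "0 \<le> r"
    show "\<bar>k \<epsilon> r\<bar> \<le> (1 + 1 / \<epsilon>\<^sup>2) powr (h + s) * (1 + r\<^sup>2) powr (- (h + s))"
      using truncated_kernel_le[of "h + s" \<epsilon> r] that s h(1) by (auto simp: k_def)
  qed auto
  \<comment> \<open>With \<open>\<epsilon> = inverse t\<close> the one-sided limit at 0 becomes a
    limit at infinity.\<close>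
  have "((\<lambda>t. \<integral>y. second_difference u x y * k (inverse t) (norm y) \<partial>lborel) \<longlongrightarrow>
       (\<integral>y. second_difference u x y * norm y powr (- 2 * (h + s)) \<partial>lborel)) at_top"
  proof (rule integral_dominated_convergence_at_top[where w = "\<lambda>y. norm (second_difference u x y * norm y powr (- 2 * (h + s)))"])
    show "integrable lborel (\<lambda>y. norm (second_difference u x y * norm y powr (- 2 * (h + s))))"
      using integrable_second_difference by (rule integrable_norm)
    show "\<forall>\<^sub>F t in at_top. AE y in lborel. norm (second_difference u x y * k (inverse t) (norm y))
        \<le> norm (second_difference u x y * norm y powr (- 2 * (h + s)))"
      by (intro always_eventually allI AE_I2) (auto simp: k_def)
    show "AE y in lborel. ((\<lambda>t. second_difference u x y * k (inverse t) (norm y)) \<longlongrightarrow>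
        second_difference u x y * norm y powr (- 2 * (h + s))) at_top"
    proof (rule AE_I2)
      fix y :: 'a
      have "\<forall>\<^sub>F t in at_top. second_difference u x y * k (inverse t) (norm y) = second_difference u x y * norm y powr (- 2 * (h + s))"
      proof (cases "y = 0")
        case False
        have "\<forall>\<^sub>F t in at_top. inverse t < norm y"
          using False by (intro order_tendstoD(2)[OF tendsto_inverse_0_at_top[OF filterlim_ident]]) auto
        then show ?thesis by eventually_elim (simp add: k_def)
      qed (simp add: k_def)
      then show "((\<lambda>t. second_difference u x y * k (inverse t) (norm y)) \<longlongrightarrow>
        second_difference u x y * norm y powr (- 2 * (h + s))) at_top"
        by (rule tendsto_eventually)
    qed
  qed (simp_all add: second_difference_def)
  then have "((\<lambda>t. (\<integral>y. second_difference u x y * k (inverse t) (norm y) \<partial>lborel) / 2) \<longlongrightarrow>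
       (\<integral>y. second_difference u x y * norm y powr (- 2 * (h + s)) \<partial>lborel) / 2) at_top"
    by (intro tendsto_divide tendsto_const) auto
  then have "((\<lambda>\<epsilon>. (\<integral>y. second_difference u x y * k \<epsilon> (norm y) \<partial>lborel) / 2) \<longlongrightarrow>
       (\<integral>y. second_difference u x y * norm y powr (- 2 * (h + s)) \<partial>lborel) / 2) (at_right 0)"
    unfolding filterlim_at_right_to_top .
  moreover have "\<forall>\<^sub>F \<epsilon> in at_right 0. (\<integral>y. second_difference u x y * k \<epsilon> (norm y) \<partial>lborel) / 2 =
      (\<integral>z. (u x - u z) * k \<epsilon> (norm (x - z)) \<partial>lborel)"
    using eventually_at_right_less[of 0] by eventually_elim (simp add: eq)
  ultimately show ?thesis unfolding k_def by (rule Lim_transform_eventually)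
qed

text \<open>The regularized kernel lies below the singular one, so the same function dominates and
  the limit is that of the truncated integrals. This carries the bound obtained for the
  regularization over to the principal value.\<close>

lemma regularized_limit:
  "(\<lambda>n. \<integral>z. (u x - u z) * (1 / real (Suc n) + (norm (x - z))\<^sup>2) powr (- (h + s)) \<partial>lborel) \<longlonglongrightarrow>
     (\<integral>y. second_difference u x y * norm y powr (- 2 * (h + s)) \<partial>lborel) / 2"
proof -
  have [measurable]: "u \<in> borel_measurable borel" by (simp add: u)
  define k where "k \<epsilon> r = (\<epsilon> + r\<^sup>2) powr (- (h + s))" for \<epsilon> r :: real
  have [measurable]: "k \<epsilon> \<in> borel_measurable borel" for \<epsilon> unfolding k_def by measurable
  have eq: "(\<integral>z. (u x - u z) * k \<epsilon> (norm (x - z)) \<partial>lborel) = (\<integral>y. second_difference u x y * k \<epsilon> (norm y) \<partial>lborel) / 2"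
    if e: "0 < \<epsilon>" "\<epsilon> \<le> 1" for \<epsilon>
  proof (intro integral_symmetrize integrable_diff_kernel)
    fix r :: real assume "0 \<le> r"
    \<comment> \<open>For \<open>\<epsilon> \<le> 1\<close> the base
      \<open>\<epsilon> + r\<^sup>2\<close> is at least \<open>\<epsilon> * (1 + r\<^sup>2)\<close>;
      the sequence \<open>1 / Suc n\<close> stays in this range.\<close>
    have "k \<epsilon> r \<le> (\<epsilon> * (1 + r\<^sup>2)) powr (- (h + s))"
      unfolding k_def using e s h mult_right_mono[of \<epsilon> 1 "r\<^sup>2"]
      by (intro powr_mono2') (auto simp: distrib_left intro!: mult_pos_pos add_pos_nonneg)
    then show "\<bar>k \<epsilon> r\<bar> \<le> \<epsilon> powr (- (h + s)) * (1 + r\<^sup>2) powr (- (h + s))"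
      using e by (simp add: powr_mult) (simp add: k_def)
  qed auto
  have "(\<lambda>n. \<integral>y. second_difference u x y * k (1 / real (Suc n)) (norm y) \<partial>lborel) \<longlonglongrightarrow>
       (\<integral>y. second_difference u x y * norm y powr (- 2 * (h + s)) \<partial>lborel)"
  proof (rule integral_dominated_convergence[where w = "\<lambda>y. norm (second_difference u x y * norm y powr (- 2 * (h + s)))"])
    have sq: "norm y powr (- 2 * (h + s)) = ((norm y)\<^sup>2) powr (- (h + s))" if "y \<noteq> 0" for y :: 'a
      using that by (simp add: powr_powr flip: powr_numeral)
    have z: "second_difference u x 0 = 0" by (simp add: second_difference_def)
    show "integrable lborel (\<lambda>y. norm (second_difference u x y * norm y powr (- 2 * (h + s))))"
      using integrable_second_difference by (rule integrable_norm)
    show "AE y in lborel. norm (second_difference u x y * k (1 / real (Suc n)) (norm y))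
        \<le> norm (second_difference u x y * norm y powr (- 2 * (h + s)))" for n
    proof (rule AE_I2)
      fix y :: 'a
      show "norm (second_difference u x y * k (1 / real (Suc n)) (norm y))
        \<le> norm (second_difference u x y * norm y powr (- 2 * (h + s)))"
      proof (cases "y = 0")
        case False
        have "k (1 / real (Suc n)) (norm y) \<le> norm y powr (- 2 * (h + s))"
          unfolding k_def sq[OF False] using False s h by (intro powr_mono2') auto
        moreover have "0 \<le> k (1 / real (Suc n)) (norm y)" by (simp add: k_def)
        ultimately show ?thesis by (simp add: abs_mult mult_left_mono)
      qed (simp add: z)
    qed
    show "AE y in lborel. (\<lambda>n. second_difference u x y * k (1 / real (Suc n)) (norm y)) \<longlonglongrightarrow>
        second_difference u x y * norm y powr (- 2 * (h + s))"
    proof (rule AE_I2)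
      fix y :: 'a
      show "(\<lambda>n. second_difference u x y * k (1 / real (Suc n)) (norm y)) \<longlonglongrightarrow>
        second_difference u x y * norm y powr (- 2 * (h + s))"
      proof (cases "y = 0")
        case False
        have "(\<lambda>n. k (1 / real (Suc n)) (norm y)) \<longlonglongrightarrow> (0 + (norm y)\<^sup>2) powr (- (h + s))"
          unfolding k_def using False
          by (intro tendsto_powr tendsto_add tendsto_const LIMSEQ_Suc[OF lim_1_over_n]) auto
        then show ?thesis unfolding sq[OF False] by (intro tendsto_mult tendsto_const) simp
      qed (simp add: z)
    qed
  qed (simp_all add: second_difference_def)
  then have "(\<lambda>n. (\<integral>y. second_difference u x y * k (1 / real (Suc n)) (norm y) \<partial>lborel) / 2) \<longlonglongrightarrow>
       (\<integral>y. second_difference u x y * norm y powr (- 2 * (h + s)) \<partial>lborel) / 2"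
    by (intro tendsto_divide tendsto_const) auto
  moreover have "(\<integral>z. (u x - u z) * (1 / real (Suc n) + (norm (x - z))\<^sup>2) powr (- (h + s)) \<partial>lborel) =
      (\<integral>y. second_difference u x y * k (1 / real (Suc n)) (norm y) \<partial>lborel) / 2" for n
    using eq[of "1 / real (Suc n)"] by (simp add: k_def)
  ultimately show ?thesis by (simp only:)
qed

end

subsection \<open>The fractional Laplacian of a power\<close>

lemma frac_laplacian_trunc_power:
  fixes x :: "real ^ 'n"
  assumes N: "CARD('n) \<ge> 2" and s: "0 < s" "s < 1" and a: "0 < a" "a + s < real CARD('n) / 2" and x: "x \<noteq> 0"
  obtains L where "(frac_laplacian_trunc s (\<lambda>z. norm z powr (- 2 * a)) x \<longlongrightarrow> L) (at_right 0)"
    and "L \<ge> c_s CARD('n) s (- 2 * a) * norm x powr (- 2 * a - 2 * s)"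
proof
  define h where "h = real CARD('n) / 2"
  define u where "u = (\<lambda>z :: real ^ 'n. norm z powr (- 2 * a))"
  define A where "A = (\<integral>y. second_difference u x y * norm y powr (- 2 * (h + s)) \<partial>lborel) / 2"
  have pre: "0 < a" "a < h" "0 < s" "s < 1" "1 \<le> h" "h = real DIM(real ^ 'n) / 2"
    using N s a by (auto simp: h_def)
  have G: "0 < Gamma a" "0 < Gamma (1 - s)" "0 < Gamma (a + s)" "0 < Gamma (h + s)"
      "0 < Gamma (h - s - a)" "0 < Gamma (h - a)"
    using pre a by (auto intro!: Gamma_real_pos simp: h_def)
  have C: "0 < C_Ns CARD('n) s"
    using G s by (auto simp: C_Ns_def h_def add_divide_distrib intro!: mult_pos_pos divide_pos_pos)
  have trunc: "frac_laplacian_trunc s u x \<epsilon> = C_Ns CARD('n) s *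
      (\<integral>z. (u x - u z) * (if \<epsilon> \<le> norm (x - z) then norm (x - z) powr (- 2 * (h + s)) else 0) \<partial>lborel)" for \<epsilon>
  proof -
    have "indicator (- ball x \<epsilon>) z *\<^sub>R ((u x - u z) / norm (x - z) powr (real CARD('n) + 2 * s))
       = (u x - u z) * (if \<epsilon> \<le> norm (x - z) then norm (x - z) powr (- 2 * (h + s)) else 0)" for z
    proof -
      have "- 2 * (h + s) = - (real CARD('n) + 2 * s)" by (simp add: h_def)
      then show ?thesis by (simp only: powr_minus_divide) (auto simp: indicator_def dist_norm)
    qed
    \<comment> \<open>Borel measurability identifies the integral over \<open>lebesgue\<close> with
      the one over \<open>lborel\<close> used for the limits.\<close>
    moreover have "(\<lambda>z. (u x - u z) * (if \<epsilon> \<le> norm (x - z) then norm (x - z) powr (- 2 * (h + s)) else 0)) \<in> borel_measurable lborel"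
      unfolding u_def by measurable
    ultimately show ?thesis
      unfolding frac_laplacian_trunc_def set_lebesgue_integral_def by (simp only: integral_completion)
  qed
  show "(frac_laplacian_trunc s (\<lambda>z. norm z powr (- 2 * a)) x \<longlongrightarrow> C_Ns CARD('n) s * A) (at_right 0)"
    unfolding u_def[symmetric] trunc A_def
    by (intro tendsto_mult tendsto_const truncated_limit[OF pre x u_def])
  have "A \<ge> pi powr h * Gamma (a + s) / (Gamma a * Gamma (h + s)) *
      (Gamma (1 - s) * Gamma (h - a) / (s * Gamma (h - s - a))) * norm x powr (- 2 * a - 2 * s)"
    using regularized_limit_ge[OF a(1) s x, of A] regularized_limit[OF pre x u_def] a
    unfolding A_def pre(6)[symmetric] by (simp add: u_def h_def)
  then have "C_Ns CARD('n) s * (pi powr h * Gamma (a + s) / (Gamma a * Gamma (h + s)) *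
      (Gamma (1 - s) * Gamma (h - a) / (s * Gamma (h - s - a))) * norm x powr (- 2 * a - 2 * s)) \<le> C_Ns CARD('n) s * A"
    using C by (intro mult_left_mono) auto
  \<comment> \<open>The normalization \<open>C_Ns\<close> cancels the powers of \<open>pi\<close>,
    the factor \<open>s\<close>, \<open>Gamma (h + s)\<close> and \<open>Gamma (1 - s)\<close>; the
    four Gamma values of \<open>c_s\<close> remain.\<close>
  moreover have e: "C_Ns CARD('n) s * (pi powr h * Gamma (a + s) / (Gamma a * Gamma (h + s)) *
      (Gamma (1 - s) * Gamma (h - a) / (s * Gamma (h - s - a)))) = c_s CARD('n) s (- 2 * a)"
  proof -
    have e: "(real CARD('n) + 2 * s) / 2 = h + s" "(real CARD('n) + - 2 * a) / 2 = h - a"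
      "(2 * s - - 2 * a) / 2 = a + s" "- (- 2 * a) / 2 = a" "(real CARD('n) - 2 * s + - 2 * a) / 2 = h - s - a"
      "- real CARD('n) / 2 = - h"
      by (auto simp: h_def field_simps)
    obtain g where g: "Gamma (1 - s) = g" "0 < g" using G(2) by blast
    show ?thesis unfolding C_Ns_def c_s_def e g(1) using G(1,3-) g(2) s(1)
      by (simp add: rGamma_inverse_Gamma powr_minus divide_simps)
  qed
  ultimately show "C_Ns CARD('n) s * A \<ge> c_s CARD('n) s (- 2 * a) * norm x powr (- 2 * a - 2 * s)"
    unfolding e[symmetric] by (simp only: mult.assoc)
qed

lemma frac_laplacian_trunc_cmult:
  "frac_laplacian_trunc s (\<lambda>z. k * u z) x = (\<lambda>\<epsilon>. k * frac_laplacian_trunc s u x \<epsilon>)"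
proof
  fix \<epsilon>
  have "(k * u x - k * u z) / norm (x - z) powr (real CARD('a) + 2 * s)
      = k * ((u x - u z) / norm (x - z) powr (real CARD('a) + 2 * s))" for z
    by (simp add: right_diff_distrib)
  then show "frac_laplacian_trunc s (\<lambda>z. k * u z) x \<epsilon> = k * frac_laplacian_trunc s u x \<epsilon>"
    by (simp only: frac_laplacian_trunc_def set_integral_mult_right mult.left_commute)
qed

lemma hardy_op_power_ge:
  fixes x :: "real ^ 'n"
  assumes N: "CARD('n) \<ge> 2" and s: "0 < s" "s < 1" and a: "0 < a" "a + s < real CARD('n) / 2"
    and x: "x \<noteq> 0" and k: "0 \<le> k"
  shows "frac_laplacian_exists s (\<lambda>z. k * norm z powr (- 2 * a)) x"
    and "hardy_op s \<mu> (\<lambda>z. k * norm z powr (- 2 * a)) x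
           \<ge> k * (c_s CARD('n) s (- 2 * a) + \<mu>) * norm x powr (- 2 * a - 2 * s)"
proof -
  obtain L where L: "(frac_laplacian_trunc s (\<lambda>z. norm z powr (- 2 * a)) x \<longlongrightarrow> L) (at_right 0)"
    "L \<ge> c_s CARD('n) s (- 2 * a) * norm x powr (- 2 * a - 2 * s)"
    using frac_laplacian_trunc_power[OF N s a x] by blast
  have lim: "(frac_laplacian_trunc s (\<lambda>z. k * norm z powr (- 2 * a)) x \<longlongrightarrow> k * L) (at_right 0)"
    unfolding frac_laplacian_trunc_cmult by (intro tendsto_mult tendsto_const L)
  then show "frac_laplacian_exists s (\<lambda>z. k * norm z powr (- 2 * a)) x"
    unfolding frac_laplacian_exists_def by blast
  have "frac_laplacian s (\<lambda>z. k * norm z powr (- 2 * a)) x = k * L"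
    unfolding frac_laplacian_def by (rule tendsto_Lim[OF _ lim]) simp
  moreover have "\<mu> / norm x powr (2 * s) * (k * norm x powr (- 2 * a)) = k * \<mu> * norm x powr (- 2 * a - 2 * s)"
    by (simp add: powr_diff)
  ultimately show "hardy_op s \<mu> (\<lambda>z. k * norm z powr (- 2 * a)) x
           \<ge> k * (c_s CARD('n) s (- 2 * a) + \<mu>) * norm x powr (- 2 * a - 2 * s)"
    unfolding hardy_op_def using mult_left_mono[OF L(2) k] by (simp add: algebra_simps)
qed

text \<open>Lets the weight in the definition of \<open>L1s\<close> be compared with the regularized
  kernel; the cases \<open>r \<le> 1\<close> and \<open>r > 1\<close> differ in which summand of
  \<open>1 + r\<^sup>2\<close> dominates.\<close>

lemma one_plus_square_powr_le:
  fixes q r :: real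
  assumes "0 < q" "0 \<le> r"
  shows "(1 + r\<^sup>2) powr q \<le> 2 powr q * (1 + r powr (2 * q))"
proof (cases "r \<le> 1")
  case True
  then have "(1 + r\<^sup>2) powr q \<le> 2 powr q"
    using assms power_le_one[of r 2] by (intro powr_mono2) auto
  also have "\<dots> \<le> 2 powr q * (1 + r powr (2 * q))" by simp
  finally show ?thesis .
next
  case False
  then have "1 \<le> r\<^sup>2" by simp
  then have "(1 + r\<^sup>2) powr q \<le> (2 * r\<^sup>2) powr q"
    using assms by (intro powr_mono2) auto
  also have "\<dots> = 2 powr q * r powr (2 * q)"
    using False by (simp add: powr_mult powr_powr flip: powr_numeral)
  also have "\<dots> \<le> 2 powr q * (1 + r powr (2 * q))" by simp
  finally show ?thesis .
qed

text \<open>Both conditions follow from integrability of the single function \<open>g\<close>, the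
  Riesz integrand with \<open>x = 0\<close> and \<open>e = 1\<close>: its weight is bounded below on
  compact sets and comparable with the weight of \<open>L1s\<close> globally.\<close>

lemma power_in_L1s:
  assumes s: "0 < s" and a: "0 < a" "a < real CARD('n) / 2" and k: "0 \<le> k"
  shows "(\<lambda>z :: real ^ 'n. k * norm z powr (- 2 * a)) \<in> L1s s"
proof -
  define q where "q = real CARD('n) / 2 + s"
  have q: "0 < q" using s by (simp add: q_def add_nonneg_pos)
  define g where "g z = k * norm z powr (- 2 * a) * (1 + (norm z)\<^sup>2) powr (- q)" for z :: "real ^ 'n"
  have g0: "0 \<le> g z" for z using k by (simp add: g_def)
  have ig: "integrable lborel g"
    using integrable_mult_right[OF integrable_riesz[of a s 1 "0 :: real ^ 'n"], of k] s a
    by (simp add: g_def[abs_def] q_def mult.assoc)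
  have one: "k * norm z powr (- 2 * a) = (1 + (norm z)\<^sup>2) powr q * g z" for z :: "real ^ 'n"
  proof -
    have "(1 + (norm z)\<^sup>2) powr q * (1 + (norm z)\<^sup>2) powr (- q) = 1"
      unfolding powr_add[symmetric] by (simp add: add_pos_nonneg less_imp_neq[symmetric])
    then show ?thesis by (simp add: g_def mult_ac)
  qed
  have "set_integrable lebesgue K (\<lambda>z :: real ^ 'n. k * norm z powr (- 2 * a))" if K: "compact K" for K
  proof -
    have [measurable]: "K \<in> sets borel" using K by (simp add: borel_compact)
    obtain R where R: "\<And>z. z \<in> K \<Longrightarrow> norm z \<le> R"
      using compact_imp_bounded[OF K] by (auto simp: bounded_iff)
    have "integrable lborel (\<lambda>z. indicator K z *\<^sub>R (k * norm z powr (- 2 * a)))"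
    proof (rule Bochner_Integration.integrable_bound)
      show "integrable lborel (\<lambda>z. (1 + R\<^sup>2) powr q * g z)" using ig by simp
      show "AE z in lborel. norm (indicator K z *\<^sub>R (k * norm z powr (- 2 * a))) \<le> norm ((1 + R\<^sup>2) powr q * g z)"
      proof (rule AE_I2)
        fix z :: "real ^ 'n"
        show "norm (indicator K z *\<^sub>R (k * norm z powr (- 2 * a))) \<le> norm ((1 + R\<^sup>2) powr q * g z)"
        proof (cases "z \<in> K")
          case True
          then have "(1 + (norm z)\<^sup>2) powr q \<le> (1 + R\<^sup>2) powr q"
            using R q by (intro powr_mono2 add_left_mono power_mono) auto
          then have "k * norm z powr (- 2 * a) \<le> (1 + R\<^sup>2) powr q * g z"
            unfolding one by (intro mult_right_mono g0)
          then show ?thesis using True g0 k by (simp add: abs_mult)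
        qed simp
      qed
    qed simp
    then show ?thesis unfolding set_integrable_def by (subst integrable_completion) auto
  qed
  moreover have "integrable lborel (\<lambda>z :: real ^ 'n. \<bar>k * norm z powr (- 2 * a)\<bar> / (1 + norm z powr (real CARD('n) + 2 * s)))"
  proof (rule Bochner_Integration.integrable_bound)
    show "integrable lborel (\<lambda>z. 2 powr q * g z)" using ig by simp
    show "AE z in lborel. norm (\<bar>k * norm z powr (- 2 * a)\<bar> / (1 + norm z powr (real CARD('n) + 2 * s))) \<le> norm (2 powr q * g z)"
    proof (rule AE_I2)
      fix z :: "real ^ 'n"
      have e: "real CARD('n) + 2 * s = 2 * q" by (simp add: q_def)
      have p: "0 < 1 + norm z powr (2 * q)" by (simp add: add_pos_nonneg)
      have "\<bar>k * norm z powr (- 2 * a)\<bar> = (1 + (norm z)\<^sup>2) powr q * g z" using k by (simp flip: one)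
      also have "\<dots> \<le> (2 powr q * (1 + norm z powr (2 * q))) * g z"
        by (intro mult_right_mono g0 one_plus_square_powr_le q) simp
      finally show "norm (\<bar>k * norm z powr (- 2 * a)\<bar> / (1 + norm z powr (real CARD('n) + 2 * s))) \<le> norm (2 powr q * g z)"
        unfolding e using p g0[of z] by (simp add: field_simps abs_mult)
    qed
  qed simp
  then have "integrable lebesgue (\<lambda>z :: real ^ 'n. \<bar>k * norm z powr (- 2 * a)\<bar> / (1 + norm z powr (real CARD('n) + 2 * s)))"
    by (subst integrable_completion) auto
  ultimately show ?thesis unfolding L1s_def by simp
qed

subsection \<open>The exponents\<close>

text \<open>At the midpoint the four Gamma arguments coincide in pairs, which produces the squares
  in \<open>mu0\<close>.\<close>

lemma c_s_critical: "c_s N s ((2 * s - real N) / 2) = - mu0 N s"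
proof -
  have e: "(real N + (2 * s - real N) / 2) / 2 = (real N + 2 * s) / 4"
    "(2 * s - (2 * s - real N) / 2) / 2 = (real N + 2 * s) / 4"
    "- ((2 * s - real N) / 2) / 2 = (real N - 2 * s) / 4"
    "(real N - 2 * s + (2 * s - real N) / 2) / 2 = (real N - 2 * s) / 4"
    by (auto simp: field_simps)
  show ?thesis unfolding c_s_def mu0_def e
    by (simp add: rGamma_inverse_Gamma power2_eq_square field_simps)
qed

text \<open>The sign is that of \<open>rGamma (- \<tau> / 2)\<close>, read off from the recursion
  because \<open>1 - \<tau> / 2\<close> is positive. For negative \<open>\<mu>\<close> this rules
  out zeros of \<open>c_s + \<mu>\<close> in the range \<open>\<tau> \<ge> 0\<close>.\<close>

lemma c_s_nonpos:
  assumes "2 * s < real N" "0 \<le> \<tau>" "\<tau> < 2 * s" "s < 1"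
  shows "c_s N s \<tau> \<le> 0"
proof -
  have "rGamma (- \<tau> / 2) = (- \<tau> / 2) * rGamma (- \<tau> / 2 + 1)"
    by (rule rGamma_plus1[symmetric])
  moreover have "0 < rGamma (- \<tau> / 2 + 1)"
    using assms by (simp add: rGamma_inverse_Gamma Gamma_real_pos)
  ultimately have "rGamma (- \<tau> / 2) \<le> 0"
    using assms by (simp add: mult_nonneg_nonpos2 zero_le_mult_iff)
  moreover have "0 < Gamma ((real N + \<tau>) / 2)" "0 < Gamma ((2 * s - \<tau>) / 2)" "0 < rGamma ((real N - 2 * s + \<tau>) / 2)"
    using assms by (auto simp: rGamma_inverse_Gamma intro!: Gamma_real_pos)
  ultimately show ?thesis unfolding c_s_def
    by (intro mult_nonpos_nonneg mult_nonneg_nonpos mult_nonneg_nonneg) auto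
qed

text \<open>\<open>c_s\<close> falls from \<open>- mu0\<close>, which exceeds
  \<open>- \<mu>\<close>, at the midpoint to 0, which is below \<open>- \<mu>\<close>, at the
  origin. The level set in between is nonempty and compact, so it has a greatest element, which
  gives \<open>GREATEST\<close> its intended value; strictness at both ends follows from the two
  boundary values.\<close>

lemma tau_plus_bounds:
  assumes N: "2 \<le> N" and s: "0 < s" "s < 1" and \<mu>: "mu0 N s < \<mu>" "\<mu> < 0"
  shows "(2 * s - real N) / 2 < tau_plus N s \<mu>" "tau_plus N s \<mu> < 0"
proof -
  define t0 where "t0 = (2 * s - real N) / 2"
  have t0: "t0 < 0" "- real N < t0" using N s by (auto simp: t0_def)
  have cont: "continuous_on {t0..0} (c_s N s)"
    unfolding c_s_def[abs_def] using t0 s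
    by (intro continuous_at_imp_continuous_on ballI isCont_mult isCont_Gamma isCont_rGamma isCont_divide
          isCont_add isCont_diff isCont_minus continuous_const continuous_ident)
       (auto dest!: nonpos_Ints_nonpos)
  have c0: "c_s N s 0 = 0" by (simp add: c_s_def)
  have ct0: "c_s N s t0 = - mu0 N s" unfolding t0_def by (rule c_s_critical)
  define Z where "Z = {t \<in> {t0..0}. c_s N s t = - \<mu>}"
  have "\<exists>t\<ge>t0. t \<le> 0 \<and> c_s N s t = - \<mu>"
    by (rule IVT2') (use cont c0 ct0 \<mu> t0 in auto)
  then have "Z \<noteq> {}" by (auto simp: Z_def)
  moreover have "compact Z"
  proof -
    have "closed Z" unfolding Z_def
      by (rule continuous_closed_preimage_constant[OF cont]) simp
    moreover have "bounded Z" by (rule bounded_subset[of "{t0..0}"]) (auto simp: Z_def)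
    ultimately show ?thesis by (simp add: compact_eq_bounded_closed)
  qed
  ultimately obtain t where t: "t \<in> Z" "\<And>t'. t' \<in> Z \<Longrightarrow> t' \<le> t"
    using compact_attains_sup by metis
  have "tau_plus N s \<mu> = t"
    unfolding tau_plus_def
  proof (rule Greatest_equality)
    show "t \<in> {- real N<..<2 * s} \<and> c_s N s t + \<mu> = 0"
      using t(1) t0 s by (auto simp: Z_def)
  next
    fix y assume y: "y \<in> {- real N<..<2 * s} \<and> c_s N s y + \<mu> = 0"
    have "y \<le> 0" using c_s_nonpos[of s N y] y \<mu> N s by (cases "y \<le> 0") auto
    then show "y \<le> t" using y t(2)[of y] t(1) by (cases "t0 \<le> y") (auto simp: Z_def)
  qed
  moreover have "t \<noteq> 0" "t \<noteq> t0" using t(1) c0 ct0 \<mu> by (auto simp: Z_def)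
  ultimately show "(2 * s - real N) / 2 < tau_plus N s \<mu>" "tau_plus N s \<mu> < 0"
    using t(1) by (auto simp: Z_def t0_def)
qed

subsection \<open>Many supersolutions\<close>

text \<open>Near 0 the limsup controls \<open>Q\<close>; on the remaining compact shell Holder
  continuity makes \<open>Q\<close> bounded, and there \<open>norm x powr (- \<theta>)\<close> is at
  most \<open>R powr (- \<theta>)\<close> since \<open>\<theta> < 0\<close>.\<close>

lemma potential_bound:
  fixes Q :: "real ^ 'n \<Rightarrow> real"
  assumes Q: "loc_holder_on \<beta> (- {0}) Q" and \<beta>: "0 < \<beta>" and \<theta>: "\<theta> < 0"
    and lim: "Limsup (at 0) (\<lambda>x. ereal (Q x * norm x powr (- \<theta>))) < \<infinity>"
  obtains M where "0 \<le> M" "\<And>x. x \<noteq> 0 \<Longrightarrow> norm x \<le> R \<Longrightarrow> Q x \<le> M * norm x powr \<theta>"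
proof -
  obtain m :: nat where "Limsup (at 0) (\<lambda>x. ereal (Q x * norm x powr (- \<theta>))) < ereal (real m)"
    using less_PInf_Ex_of_nat[THEN iffD1, OF less_imp_neq[OF lim]] by blast
  then have "\<forall>\<^sub>F x in at 0. ereal (Q x * norm x powr (- \<theta>)) < ereal (real m)"
    by (rule Limsup_lessD)
  then obtain \<delta> where \<delta>: "0 < \<delta>"
      "\<forall>x. x \<noteq> 0 \<and> dist x 0 < \<delta> \<longrightarrow> ereal (Q x * norm x powr (- \<theta>)) < ereal (real m)"
    by (subst (asm) eventually_at) (auto simp del: less_ereal.simps)
  define K where "K = {x :: real ^ 'n. \<delta> \<le> norm x \<and> norm x \<le> R}"
  have K: "compact K" "K \<subseteq> - {0}"
  proof -
    have "K = cball 0 R - ball 0 \<delta>" by (auto simp: K_def)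
    then show "compact K" by (simp add: compact_diff)
    show "K \<subseteq> - {0}" using \<delta>(1) by (auto simp: K_def)
  qed
  obtain C where C: "\<And>x y. x \<in> K \<Longrightarrow> y \<in> K \<Longrightarrow> \<bar>Q x - Q y\<bar> \<le> C * norm (x - y) powr \<beta>"
    using Q[unfolded loc_holder_on_def, rule_format, OF conjI[OF K]] by auto
  obtain B where B: "0 \<le> B" "\<And>x. x \<in> K \<Longrightarrow> Q x \<le> B"
  proof (cases "K = {}")
    case True
    then show thesis using that[of 0] by simp
  next
    case False
    then obtain y where y: "y \<in> K" by blast
    show thesis
    \<comment> \<open>The absolute value is taken since the Holder constant carries no sign
      condition; \<open>2 * R\<close> bounds the diameter of the shell.\<close>
    proof (rule that[of "\<bar>Q y\<bar> + \<bar>C\<bar> * (2 * R) powr \<beta>"])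
      fix x assume x: "x \<in> K"
      have "norm (x - y) \<le> 2 * R"
        using x y norm_triangle_ineq4[of x y] by (simp add: K_def)
      then have "\<bar>C\<bar> * norm (x - y) powr \<beta> \<le> \<bar>C\<bar> * (2 * R) powr \<beta>"
        using \<beta> by (intro mult_left_mono powr_mono2) auto
      moreover have "C * norm (x - y) powr \<beta> \<le> \<bar>C\<bar> * norm (x - y) powr \<beta>"
        by (intro mult_right_mono) auto
      ultimately show "Q x \<le> \<bar>Q y\<bar> + \<bar>C\<bar> * (2 * R) powr \<beta>"
        using C[OF x y] by linarith
    qed simp
  qed
  show thesis
  proof
    show "0 \<le> real m + B * R powr (- \<theta>)" using B by simp
    fix x :: "real ^ 'n" assume x: "x \<noteq> 0" "norm x \<le> R"
    have "Q x * norm x powr (- \<theta>) \<le> real m + B * R powr (- \<theta>)"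
    proof (cases "norm x < \<delta>")
      case True
      then have "Q x * norm x powr (- \<theta>) \<le> real m" using \<delta>(2)[rule_format, of x] x(1) by simp
      then show ?thesis using B by (simp add: add_increasing2)
    next
      case False
      then have "Q x * norm x powr (- \<theta>) \<le> B * norm x powr (- \<theta>)"
        using x by (intro mult_right_mono B) (auto simp: K_def)
      also have "\<dots> \<le> B * R powr (- \<theta>)"
        using x \<theta> B by (intro mult_left_mono powr_mono2) auto
      finally show ?thesis by simp
    qed
    then have "Q x * norm x powr (- \<theta>) * norm x powr \<theta> \<le> (real m + B * R powr (- \<theta>)) * norm x powr \<theta>"
      by (rule mult_right_mono) simp
    moreover have "norm x powr (- \<theta>) * norm x powr \<theta> = 1"
      using x by (simp flip: powr_add)
    ultimately show "Q x \<le> (real m + B * R powr (- \<theta>)) * norm x powr \<theta>"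
      by (simp add: mult.assoc)
  qed
qed

text \<open>Distinct factors give distinct classes: if \<open>k * u\<close> and
  \<open>k' * u\<close> agree almost everywhere, dividing by \<open>u\<close> makes the constant
  statement \<open>k = k'\<close> hold almost everywhere, hence outright, as the whole space is not
  null.\<close>

lemma infinite_quotient_multiples:
  fixes u :: "real ^ 'n \<Rightarrow> real"
  assumes u: "AE x in lebesgue. u x \<noteq> 0" and S: "\<And>k. K \<le> k \<Longrightarrow> (\<lambda>x. k * u x) \<in> S"
  shows "infinite (S // ae_eq_rel)"
proof
  assume "finite (S // ae_eq_rel)"
  have rel: "(\<lambda>x. k' * u x) \<in> ae_eq_rel `` {\<lambda>x. k * u x} \<longleftrightarrow> (AE x in lebesgue. k * u x = k' * u x)" for k k'
    unfolding ae_eq_rel_def Image_singleton_iff mem_Collect_eq case_prod_conv ..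
  have "(\<lambda>k. ae_eq_rel `` {\<lambda>x. k * u x}) ` {K..} \<subseteq> S // ae_eq_rel"
    by (intro image_subsetI quotientI S) simp
  then have "finite ((\<lambda>k. ae_eq_rel `` {\<lambda>x. k * u x}) ` {K..})"
    using \<open>finite (S // ae_eq_rel)\<close> by (rule finite_subset)
  moreover have "inj_on (\<lambda>k. ae_eq_rel `` {\<lambda>x. k * u x}) {K..}"
  proof (rule inj_onI)
    fix k k' assume eq: "ae_eq_rel `` {\<lambda>x. k * u x} = ae_eq_rel `` {\<lambda>x. k' * u x}"
    have "AE x in lebesgue. k * u x = k' * u x"
      unfolding rel[symmetric] eq unfolding rel by (rule AE_I2) (rule refl)
    with u have AE: "AE x in (lebesgue :: (real ^ 'n) measure). k = k'"
      by eventually_elim (metis mult_right_cancel)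
    show "k = k'"
    proof (rule ccontr)
      assume "k \<noteq> k'"
      then have "emeasure (lebesgue :: (real ^ 'n) measure) UNIV = 0"
        using AE AE_iff_measurable[of UNIV "lebesgue :: (real ^ 'n) measure" "\<lambda>x. k = k'"] by auto
      moreover have "emeasure (lebesgue :: (real ^ 'n) measure) UNIV = \<infinity>"
        using emeasure_lborel_UNIV main_part_sets[of UNIV "lborel :: (real ^ 'n) measure"] by simp
      ultimately show False by simp
    qed
  qed
  ultimately have "finite {K..}" by (rule finite_imageD)
  then show False using infinite_Ici[of K] by contradiction
qed

theorem theorem1p2:
  fixes s \<mu> \<beta> \<theta> :: real
    and \<Omega> :: "(real ^ 'n) set"
    and Q :: "real ^ 'n \<Rightarrow> real"
  assumes "CARD('n) \<ge> 2"
    and "s \<in> {0<..<1}"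
    and "bounded_C2_domain \<Omega>" and "0 \<in> \<Omega>"
    and "\<mu> \<in> {mu0 CARD('n) s<..<0}"
    and "\<beta> \<in> {0<..<1}" and "loc_holder_on \<beta> (- {0}) Q"
    and "\<forall>x. x \<noteq> 0 \<longrightarrow> Q x > 0"
    and "Liminf (at 0) (\<lambda>x. ereal (Q x * norm x powr (- \<theta>))) > 0"
    and "Limsup (at 0) (\<lambda>x. ereal (Q x * norm x powr (- \<theta>))) < \<infinity>"
    and "\<theta> \<in> {tau_plus CARD('n) s \<mu> - 2 * s <..< - 2 * s}"
  shows "p_sharp CARD('n) s \<mu> \<theta> \<in> {0<..<1} \<and>
         infinite ({u. positive_classical_solution s \<mu> Q (p_sharp CARD('n) s \<mu> \<theta>) \<Omega> u} // ae_eq_rel)"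
proof
  define t where "t = tau_plus CARD('n) s \<mu>"
  define p where "p = p_sharp CARD('n) s \<mu> \<theta>"
  \<comment> \<open>Chosen so that \<open>- 2 * a\<close> is the midpoint
    \<open>(2 * s - N) / 2\<close>.\<close>
  define a where "a = (real CARD('n) - 2 * s) / 4"
  have N: "2 \<le> CARD('n)" and s: "0 < s" "s < 1" and \<mu>: "mu0 CARD('n) s < \<mu>" "\<mu> < 0"
    and \<beta>: "0 < \<beta>" and \<theta>: "t - 2 * s < \<theta>" "\<theta> < - 2 * s"
    using assms by (auto simp: t_def)
  have t: "- 2 * a < t" "t < 0"
    using tau_plus_bounds[OF N s \<mu>] by (auto simp: t_def a_def field_simps)
  have a: "0 < a" "a + s < real CARD('n) / 2"
    using N s by (auto simp: a_def field_simps)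
  have p_eq: "(1 - p) * t = 2 * s + \<theta>"
    using t by (simp add: p_def p_sharp_def t_def[symmetric] field_simps)
  have "- 1 < (2 * s + \<theta>) / (- t)" "(2 * s + \<theta>) / (- t) < 0"
    using t \<theta> by (auto simp: field_simps)
  then have p: "0 < p" "p < 1" by (auto simp: p_def p_sharp_def t_def)
  then show "p_sharp CARD('n) s \<mu> \<theta> \<in> {0<..<1}" by (simp add: p_def)
  define c where "c = c_s CARD('n) s (- 2 * a) + \<mu>"
  have "- 2 * a = (2 * s - real CARD('n)) / 2" by (simp add: a_def field_simps)
  then have "c = - mu0 CARD('n) s + \<mu>" by (simp only: c_def c_s_critical)
  then have c: "0 < c" using \<mu> by simp
  \<comment> \<open>\<open>\<eta>\<close> is the surplus of the exponent
    \<open>\<theta> - 2 * a * p\<close> of the source over the exponent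
    \<open>- 2 * a - 2 * s\<close> of the operator term.\<close>
  define \<eta> where "\<eta> = \<theta> - 2 * a * p + 2 * a + 2 * s"
  have "\<eta> = (1 - p) * (t + 2 * a)" using p_eq by (simp add: \<eta>_def algebra_simps)
  then have \<eta>: "0 < \<eta>" using p t by simp
  obtain R where R: "\<And>x. x \<in> \<Omega> \<Longrightarrow> norm x \<le> R"
    using assms(3) by (auto simp: bounded_C2_domain_def bounded_iff)
  obtain M where M: "0 \<le> M" "\<And>x. x \<noteq> 0 \<Longrightarrow> norm x \<le> R \<Longrightarrow> Q x \<le> M * norm x powr \<theta>"
    using potential_bound[OF assms(7) \<beta> _ assms(10), of R] \<theta> s by auto
  define M' where "M' = M * R powr \<eta>"
  have M'0: "0 \<le> M'" using M by (simp add: M'_def)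
  \<comment> \<open>The threshold solves \<open>k powr (1 - p) \<ge> M' / c\<close>, that is
    \<open>k powr p * M' \<le> k * c\<close>; the maximum with 1 keeps \<open>k\<close>
    positive.\<close>
  define K where "K = max 1 ((M' / c) powr (1 / (1 - p)))"
  define u where "u = (\<lambda>z :: real ^ 'n. norm z powr (- 2 * a))"
  have source: "Q x * (k * u x) powr p \<le> k * c * norm x powr (- 2 * a - 2 * s)"
    if x: "x \<in> \<Omega>" "x \<noteq> 0" and k: "K \<le> k" for x k
  proof -
    have k1: "1 \<le> k" "(M' / c) powr (1 / (1 - p)) \<le> k" using k by (auto simp: K_def)
    have "((M' / c) powr (1 / (1 - p))) powr (1 - p) \<le> k powr (1 - p)"
      using k1 p by (intro powr_mono2) auto
    moreover have "((M' / c) powr (1 / (1 - p))) powr (1 - p) = M' / c"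
      using p M'0 c by (simp add: powr_powr)
    ultimately have "M' \<le> k powr (1 - p) * c" using c by (simp add: field_simps)
    then have "k powr p * M' \<le> k powr p * (k powr (1 - p) * c)"
      by (intro mult_left_mono) auto
    also have "\<dots> = k * c" using k1 by (simp flip: mult.assoc powr_add)
    finally have kM: "k powr p * M' \<le> k * c" .
    have u: "(k * u x) powr p = k powr p * norm x powr (- 2 * a * p)"
      using k1 by (simp add: u_def powr_mult powr_powr)
    have "Q x * (k * u x) powr p \<le> (M * norm x powr \<theta>) * (k powr p * norm x powr (- 2 * a * p))"
      unfolding u using M(2)[OF x(2) R[OF x(1)]] by (intro mult_right_mono) auto
    also have "\<dots> = k powr p * (M * (norm x powr \<theta> * norm x powr (- 2 * a * p)))" by (simp only: mult_ac)
    also have "norm x powr \<theta> * norm x powr (- 2 * a * p) = norm x powr \<eta> * norm x powr (- 2 * a - 2 * s)"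
      unfolding powr_add[symmetric] by (rule arg_cong[where f = "(powr) (norm x)"]) (simp add: \<eta>_def)
    also have "M * (norm x powr \<eta> * norm x powr (- 2 * a - 2 * s)) \<le> M' * norm x powr (- 2 * a - 2 * s)"
      unfolding M'_def mult.assoc using R[OF x(1)] \<eta> M(1)
      by (intro mult_left_mono mult_right_mono powr_mono2) auto
    then have "k powr p * (M * (norm x powr \<eta> * norm x powr (- 2 * a - 2 * s))) \<le> k powr p * (M' * norm x powr (- 2 * a - 2 * s))"
      by (intro mult_left_mono) auto
    also have "\<dots> \<le> k * c * norm x powr (- 2 * a - 2 * s)"
      unfolding mult.assoc[symmetric] using kM by (intro mult_right_mono) auto
    finally show ?thesis .
  qed
  have sol: "positive_classical_solution s \<mu> Q p \<Omega> (\<lambda>x. k * u x)" if k: "K \<le> k" for k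
  proof -
    have k1: "1 \<le> k" using k by (auto simp: K_def)
    have "(\<lambda>x. k * u x) \<in> L1s s"
      unfolding u_def using s a k1 by (intro power_in_L1s) auto
    moreover have "continuous_on (\<Omega> - {0}) (\<lambda>x. k * u x)"
      unfolding u_def by (intro continuous_intros) auto
    moreover have "frac_laplacian_exists s (\<lambda>x. k * u x) x \<and> hardy_op s \<mu> (\<lambda>x. k * u x) x \<ge> Q x * (k * u x) powr p"
      if "x \<in> \<Omega> - {0}" for x
      using hardy_op_power_ge(1)[OF N s a, of x k] hardy_op_power_ge(2)[OF N s a, of x k \<mu>] source[of x k] that k k1
      unfolding c_def u_def by auto
    moreover have "0 \<le> k * u x" for x using k1 by (simp add: u_def)
    moreover have "0 < k * u x" if "x \<noteq> 0" for x using k1 that by (simp add: u_def)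
    ultimately show ?thesis
      unfolding positive_classical_solution_def classical_solution_def by auto
  qed
  \<comment> \<open>The origin is the exception, as \<open>u 0 = 0\<close> by the convention for
    \<open>powr\<close>.\<close>
  have "AE x in lebesgue. u x \<noteq> 0"
    using AE_completion[OF AE_lborel_singleton[of "0 :: real ^ 'n"]]
    by eventually_elim (simp add: u_def)
  then have "infinite ({u. positive_classical_solution s \<mu> Q p \<Omega> u} // ae_eq_rel)"
    by (rule infinite_quotient_multiples[where K = K]) (simp add: sol)
  then show "infinite ({u. positive_classical_solution s \<mu> Q (p_sharp CARD('n) s \<mu> \<theta>) \<Omega> u} // ae_eq_rel)"
    unfolding p_def .
qed

end
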